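(* The following identities of power series in $q$ hold: $$\sum_{n=0}^{\infty}B_3(6n)q^n=\frac{f_2^{10}f_3^9}{f_1^7f_6^6}+16q\frac{f_2^7f_6^3}{f_1^4}+27q\frac{f_2^2f_3^5f_6^2}{f_1^3},$$ $$\sum_{n=0}^{\infty}B_3(6n+4)q^n=24\frac{f_2^8f_3^3}{f_1^5}.$$
   Context: For a positive integer $k$, $f_k=(q^k;q^k)_\infty=\prod_{m=1}^{\infty}(1-q^{km})$ (as a formal power series in $q$, or for $|q|<1$). A partition is a 3-core if none of its hook numbers is a multiple of 3 (the empty partition is a 3-core). For an integer $n\ge 0$, $B_3(n)$ denotes the number of partition triples of $n$ with 3-cores, i.e. ordered triples $(\lambda_1,\lambda_2,\lambda_3)$ of (possibly empty) partitions, each a 3-core, such that the sum of all the parts of $\lambda_1,\lambda_2,\lambda_3$ equals $n$; in particular $B_3(0)=1$. Equivalently (a standard fact recalled in the paper), $\sum_{n\ge 0}B_3(n)q^n=\dfrac{f_3^9}{f_1^3}$. *)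

theory Defs
  imports
    "HOL-Analysis.Infinite_Products"
    "HOL-Computational_Algebra.Formal_Power_Series"
begin

section \<open>Partitions, hook numbers and cores\<close>

text \<open>A partition is the list of its parts in weakly decreasing order; the empty list is allowed.\<close>

definition is_partition :: "nat list \<Rightarrow> bool" where
  "is_partition xs \<longleftrightarrow> sorted_wrt (\<ge>) xs \<and> (\<forall>x\<in>set xs. x > 0)"

text \<open>Rows and columns of the Young diagram are numbered from 0, row \<open>i\<close> consisting of the cells
  \<open>(i, j)\<close> with \<open>j < xs ! i\<close>. The functions below are meaningful for cells of the diagram only.\<close>

definition cells :: "nat list \<Rightarrow> (nat \<times> nat) set" where
  "cells xs = {(i, j). i < length xs \<and> j < xs ! i}"

definition arm :: "nat list \<Rightarrow> nat \<times> nat \<Rightarrow> nat" where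
  "arm xs = (\<lambda>(i, j). card {j'. j < j' \<and> (i, j') \<in> cells xs})"

definition leg :: "nat list \<Rightarrow> nat \<times> nat \<Rightarrow> nat" where
  "leg xs = (\<lambda>(i, j). card {i'. i < i' \<and> (i', j) \<in> cells xs})"

definition hook_number :: "nat list \<Rightarrow> nat \<times> nat \<Rightarrow> nat" where
  "hook_number xs c = arm xs c + leg xs c + 1"

definition is_core :: "nat \<Rightarrow> nat list \<Rightarrow> bool" where
  "is_core t xs \<longleftrightarrow> is_partition xs \<and> (\<forall>c\<in>cells xs. \<not> t dvd hook_number xs c)"

definition core_triples :: "nat \<Rightarrow> (nat list \<times> nat list \<times> nat list) set" where
  "core_triples n = {(xs, ys, zs). is_core 3 xs \<and> is_core 3 ys \<and> is_core 3 zs \<and>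
     sum_list xs + sum_list ys + sum_list zs = n}"

definition B3 :: "nat \<Rightarrow> nat" where
  "B3 n = card (core_triples n)"

lemma finite_partitions_le: "finite {xs. is_partition xs \<and> sum_list xs \<le> n}"
proof (rule finite_subset)
  have len: "length xs \<le> sum_list xs" if "\<forall>x\<in>set xs. x > 0" for xs :: "nat list"
    using that by (induction xs) auto
  show "{xs. is_partition xs \<and> sum_list xs \<le> n} \<subseteq> {xs. set xs \<subseteq> {..n} \<and> length xs \<le> n}"
    using len by (force simp: is_partition_def dest: member_le_sum_list)
  show "finite {xs. set xs \<subseteq> {..n} \<and> length xs \<le> n}"
    by (rule finite_lists_length_le) simp
qed

text \<open>The cardinality in the definition of \<open>B3\<close> is that of a finite set.\<close>

lemma finite_core_triples: "finite (core_triples n)"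
proof (rule finite_subset)
  let ?P = "{xs. is_partition xs \<and> sum_list xs \<le> n}"
  show "core_triples n \<subseteq> ?P \<times> ?P \<times> ?P"
    by (auto simp: core_triples_def is_core_def)
  show "finite (?P \<times> ?P \<times> ?P)"
    using finite_partitions_le by blast
qed

lemma B3_0: "B3 0 = 1"
proof -
  have "is_partition xs \<Longrightarrow> sum_list xs = 0 \<Longrightarrow> xs = []" for xs
    by (cases xs) (auto simp: is_partition_def)
  moreover have "is_core 3 []"
    by (simp add: is_core_def is_partition_def cells_def)
  ultimately have "core_triples 0 = {([], [], [])}"
    by (auto simp: core_triples_def is_core_def)
  then show ?thesis by (simp add: B3_def)
qed

section \<open>The products $(q^k;q^k)_\infty$\<close>

text \<open>Power series in $q$ are formal power series over the rationals with \<open>q = fps_X\<close>; the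
  infinite product is taken in the usual topology on them. The index of \<open>prodinf\<close> starts
  at 0, hence the \<open>Suc\<close>.\<close>

definition f :: "nat \<Rightarrow> rat fps" where
  "f k = (\<Prod>m. 1 - fps_X ^ (k * Suc m))"

text \<open>The product converges for \<open>k > 0\<close>, and dividing by it is multiplication by the inverse
  power series.\<close>

lemma f_has_prod:
  assumes "k > 0"
  shows "(\<lambda>m. 1 - fps_X ^ (k * Suc m)) has_prod f k" and "fps_nth (f k) 0 = 1"
proof -
  define F where "F n = (\<Prod>m\<le>n. 1 - (fps_X :: rat fps) ^ (k * Suc m))" for n
  have step: "fps_nth (F (Suc n)) i = fps_nth (F n) i" if "i \<le> n" for n i
  proof -
    have "i < k * Suc (Suc n)"
      using that assms by (metis Suc_leI le_imp_less_Suc less_SucI less_le_trans mult_le_mono1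
          nat_mult_1 One_nat_def)
    moreover have "F (Suc n) = F n - F n * fps_X ^ (k * Suc (Suc n))"
      by (simp add: F_def algebra_simps)
    ultimately show ?thesis
      by (simp add: fps_X_power_mult_right_nth del: mult_Suc_right)
  qed
  have const: "fps_nth (F n) i = fps_nth (F i) i" if "n \<ge> i" for n i
    using that by (induction n rule: dec_induct) (auto simp: step)
  define P where "P = Abs_fps (\<lambda>i. fps_nth (F i) i)"
  have lim: "F \<longlonglongrightarrow> P"
    unfolding tendsto_fps_iff P_def
    by (auto intro!: tendsto_eventually eventually_sequentiallyI const)
  have P0: "fps_nth P 0 = 1"
    using assms by (simp add: P_def F_def)
  then have "P \<noteq> 0" by auto
  with lim have hp: "(\<lambda>m. 1 - fps_X ^ (k * Suc m)) has_prod P"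
    unfolding has_prod_def raw_has_prod_def F_def by simp
  moreover from hp have "f k = P"
    unfolding f_def by (rule has_prod_unique [symmetric])
  ultimately show "(\<lambda>m. 1 - fps_X ^ (k * Suc m)) has_prod f k" "fps_nth (f k) 0 = 1"
    using P0 by simp_all
qed

end

theory Submission
  imports Defs "HOL-Computational_Algebra.Polynomial"
    "HOL-Computational_Algebra.Formal_Laurent_Series"
begin

text \<open>
  \<^bold>\<open>Counting 3-cores.\<close> The beta-set of a partition (the hook numbers of its first column)
  determines it, and a partition is a $t$-core iff its beta-set is closed under subtracting $t$.
  For $t = 3$ such a set consists of an initial segment of each of the residue classes 1 and 2,
  so 3-cores correspond to pairs $(a, b)$ of natural numbers, and the size becomes the quadratic
  polynomial $h(a, b) = a^2 - ab + b^2 + b$ (\<open>card_3_cores\<close>). On $Z^2$ the polynomial $h$ has a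
  symmetry of order 3 for which the quadrant $a, b \ge 0$ is a fundamental domain; hence the
  series $C$ counting 3-cores is the sum of $q^{h(a,b)}$ over any other fundamental domain. Two
  choices of domain give the two facts about $C$ that are used, both resting on Jacobi's triple
  product or the $q$-binomial theorem behind it:

  \<^item> the domain $3 \mid a + b$ gives $C = f_3^3 / f_1$ (\<open>cores_gf_product\<close>), by comparing the
    central coefficient of $\prod_{m<6n} (1 + z q^m)$ with what it becomes when the factors are
    sorted by $m$ mod 3, and letting $n$ grow;

  \<^item> for the points where $h$ is even, the points with $a$ and $b$ even form a fundamental
    domain, which gives the 2-dissection $C(q) = (\psi\Theta)(q^2) + q\,C(q^4)$
    (\<open>cores_gf_bisection\<close>), where $\psi = f_2^2/f_1$ and $\Theta = f_2 f_3^2/(f_1 f_6)$.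

  \<^bold>\<open>From 3-cores to triples.\<close> The generating function of $B_3$ is $C^3$. By the 2-dissection its
  even part, with $q^2$ renamed to $q$, is $E = (\psi\Theta)^3 + 3q\,\psi\Theta\,C(q^2)^2$, and
  inserting the products gives $E \varphi f_6^3 = f_3^6 \psi^4 + 3q f_6^8 f_3^2$ with $\varphi = f_1^2/f_2$
  (\<open>B3_even_gf_times_phi\<close>). The theorem asks for the terms of $E$ with exponents 0 and 2 mod 3.
  Here $\varphi = x - 2qy$ and $\psi$ is proportional to $x + qy$ with the same pair $x =
  f_9^2/f_{18}$, $y = f_3 f_{18}^2/(f_6 f_9)$ of series in $q^3$. So $1/\varphi = (x^2 + 2qxy +
  4q^2y^2) / (x^3 - 8q^3y^3)$, and the required terms of $E$ are polynomials in $q^3$, $x$ and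
  $y$ times products of series in $q^3$. The series $x^3 - 8q^3y^3$ and $x^3 + q^3y^3$ are
  products of the $f_k$ since they are cubic norms (products over $q, \omega q, \omega^2 q$) of
  $\varphi$ and of a multiple of $\psi$, and the norm is multiplicative and easily computed for
  $f_k$ (\<open>norm3_f\<close>).

  \<^bold>\<open>Conclusion.\<close> Replace $q^3$ by $q$ and put $p = x^3$, $s = qy^3$. Up to a common factor, the
  part of $E$ with exponents 0 mod 3 is $p^2 + 44ps + 16s^2 = p(p + s) + 16 s(p + s) + 27 ps$,
  whose three summands are the three quotients of the theorem, and the part with exponents 2 mod
  3 is $24 x y^2 (p + s)$ (\<open>eta_quotient_identities\<close>).
\<close>

section \<open>Partitions, beta-sets and cores\<close>

text \<open>Hook numbers of the first column, from top to bottom.\<close>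

fun beta :: "nat list \<Rightarrow> nat list" where
  "beta [] = []"
| "beta (x # xs) = (x + length xs) # beta xs"

lemma length_beta [simp]: "length (beta xs) = length xs"
  by (induction xs) auto

lemma is_partition_Nil [simp]: "is_partition []"
  by (simp add: is_partition_def)

lemma is_partition_Cons:
  "is_partition (x # xs) \<longleftrightarrow> x > 0 \<and> (\<forall>y\<in>set xs. y \<le> x) \<and> is_partition xs"
  by (auto simp: is_partition_def)

lemma beta_bound: "\<forall>y\<in>set xs. y \<le> x \<Longrightarrow> b \<in> set (beta xs) \<Longrightarrow> b < x + length xs"
  by (induction xs) fastforce+

lemma beta_pos: "is_partition xs \<Longrightarrow> b \<in> set (beta xs) \<Longrightarrow> b > 0"
  by (induction xs) (auto simp: is_partition_Cons)

lemma beta_decreasing: "is_partition xs \<Longrightarrow> sorted_wrt (>) (beta xs)"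
  by (induction xs) (auto simp: is_partition_Cons dest: beta_bound)

lemma distinct_beta: "is_partition xs \<Longrightarrow> distinct (beta xs)"
  by (induction xs) (auto simp: is_partition_Cons dest: beta_bound)

text \<open>Along the rim of the diagram, column \<open>j\<close> ends at the position \<open>gap xs j\<close> while the rows
  end at the positions in \<open>beta xs\<close>; so the gaps are exactly the natural numbers outside the
  beta-set, and hook numbers are differences between an element of the beta-set and a smaller
  gap.\<close>

definition gap :: "nat list \<Rightarrow> nat \<Rightarrow> nat" where
  "gap xs j = j + length (filter (\<lambda>y. y \<le> j) xs)"

lemma gap_notin_beta: "is_partition xs \<Longrightarrow> gap xs j \<notin> set (beta xs)"
proof (induction xs)
  case (Cons x xs)
  then have p: "is_partition xs" and le: "\<forall>y\<in>set xs. y \<le> x" by (auto simp: is_partition_Cons)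
  show ?case
  proof (cases "x \<le> j")
    case True
    then have "filter (\<lambda>y. y \<le> j) xs = xs"
      using le by (auto intro!: filter_True)
    then have "gap (x # xs) j > x + length xs"
      using True by (simp add: gap_def)
    then show ?thesis using beta_bound[OF le] by force
  next
    case False
    then have "gap (x # xs) j = gap xs j" by (simp add: gap_def)
    moreover have "gap xs j < x + length xs"
      using False by (simp add: gap_def add_less_le_mono)
    ultimately show ?thesis using Cons.IH[OF p] by simp
  qed
qed simp

lemma strict_mono_gap: "strict_mono (gap xs)"
proof (rule strict_monoI)
  fix i j :: nat assume "i < j"
  then have "length (filter (\<lambda>y. y \<le> i) xs) \<le> length (filter (\<lambda>y. y \<le> j) xs)"
    by (induction xs) auto
  with \<open>i < j\<close> show "gap xs i < gap xs j" by (simp add: gap_def)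
qed

text \<open>Below the beta-number \<open>x + length xs\<close> of a new first row of length \<open>x\<close> there is room for
  exactly \<open>x\<close> gaps, so counting suffices.\<close>

lemma gap_image:
  assumes p: "is_partition xs" and le: "\<forall>y\<in>set xs. y \<le> x"
  shows "gap xs ` {..<x} = {..<x + length xs} - set (beta xs)"
proof (rule card_subset_eq)
  show "gap xs ` {..<x} \<subseteq> {..<x + length xs} - set (beta xs)"
    using gap_notin_beta[OF p] by (auto simp: gap_def add_less_le_mono)
  have "inj_on (gap xs) {..<x}"
    using strict_mono_gap strict_mono_imp_inj_on inj_on_subset by blast
  moreover have "set (beta xs) \<subseteq> {..<x + length xs}" using beta_bound[OF le] by auto
  ultimately show "card (gap xs ` {..<x}) = card ({..<x + length xs} - set (beta xs))"
    using distinct_beta[OF p] by (simp add: card_image card_Diff_subset distinct_card)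
qed simp

lemma cells_Cons [simp]:
  "(0, j) \<in> cells (x # xs) \<longleftrightarrow> j < x"
  "(Suc i, j) \<in> cells (x # xs) \<longleftrightarrow> (i, j) \<in> cells xs"
  by (auto simp: cells_def)

lemma ball_cells_Cons:
  "(\<forall>c\<in>cells (x # xs). P c) \<longleftrightarrow> (\<forall>j<x. P (0, j)) \<and> (\<forall>(i, j)\<in>cells xs. P (Suc i, j))"
proof -
  have "(\<forall>i j. (i, j) \<in> cells (x # xs) \<longrightarrow> P (i, j)) \<longleftrightarrow>
        (\<forall>j<x. P (0, j)) \<and> (\<forall>i j. (i, j) \<in> cells xs \<longrightarrow> P (Suc i, j))"
    (is "?L \<longleftrightarrow> ?R")
  proof
    assume ?R
    show ?L
    proof (intro allI impI)
      fix i j assume "(i, j) \<in> cells (x # xs)"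
      with \<open>?R\<close> show "P (i, j)" by (cases i) auto
    qed
  qed auto
  then show ?thesis by auto
qed

lemma leg_rows: "{i'. i < i' \<and> (i', j) \<in> cells (x # xs)} = Suc ` {i'. i \<le> i' \<and> (i', j) \<in> cells xs}"
proof -
  have "i < i' \<and> (i', j) \<in> cells (x # xs) \<longleftrightarrow>
      (\<exists>k. i' = Suc k \<and> i \<le> k \<and> (k, j) \<in> cells xs)" for i'
    by (cases i') auto
  then show ?thesis by auto
qed

lemma hook_number_Cons_Suc: "hook_number (x # xs) (Suc i, j) = hook_number xs (i, j)"
  by (simp add: hook_number_def arm_def leg_def leg_rows card_image Suc_le_eq)

lemma hook_number_Cons_0:
  assumes "j < x"
  shows "hook_number (x # xs) (0, j) = x + length xs - gap xs j"
proof -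
  have "leg (x # xs) (0, j) = length (filter (\<lambda>y. j < y) xs)"
  proof -
    have "leg (x # xs) (0, j) = card {i. (i, j) \<in> cells xs}"
      by (simp add: leg_def leg_rows card_image)
    then show ?thesis by (simp add: cells_def length_filter_conv_card)
  qed
  moreover have "{j'. j < j' \<and> (0, j') \<in> cells (x # xs)} = {j<..<x}"
    by auto
  then have "arm (x # xs) (0, j) = x - j - 1" by (simp add: arm_def)
  moreover have "length (filter (\<lambda>y. y \<le> j) xs) + length (filter (\<lambda>y. j < y) xs) = length xs"
    using sum_length_filter_compl[of "\<lambda>y. y \<le> j" xs] by (simp add: not_le)
  ultimately show ?thesis
    using assms by (simp add: hook_number_def gap_def)
qed

text \<open>Removing the first row changes no hook number of the other rows and removes only the
  largest element of the beta-set; the hooks of the first row are handled by \<open>gap_image\<close>.\<close>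

lemma is_core_iff_gaps:
  "is_core t xs \<longleftrightarrow> is_partition xs \<and>
     (\<forall>b\<in>set (beta xs). \<forall>c<b. c \<notin> set (beta xs) \<longrightarrow> \<not> t dvd b - c)"
proof (induction xs)
  case Nil
  show ?case by (simp add: is_core_def cells_def)
next
  case (Cons x xs)
  show ?case
  proof (cases "is_partition (x # xs)")
    case True
    then have p: "is_partition xs" and le: "\<forall>y\<in>set xs. y \<le> x" by (auto simp: is_partition_Cons)
    have "(\<forall>j<x. \<not> t dvd hook_number (x # xs) (0, j)) \<longleftrightarrow>
          (\<forall>c\<in>gap xs ` {..<x}. \<not> t dvd x + length xs - c)"
      by (auto simp: hook_number_Cons_0)
    also have "\<dots> \<longleftrightarrow> (\<forall>c<x + length xs. c \<notin> set (beta xs) \<longrightarrow> \<not> t dvd x + length xs - c)"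
      unfolding gap_image[OF p le] by auto
    finally have row0: "(\<forall>j<x. \<not> t dvd hook_number (x # xs) (0, j)) \<longleftrightarrow> \<dots>" .
    have "is_core t (x # xs) \<longleftrightarrow> (\<forall>j<x. \<not> t dvd hook_number (x # xs) (0, j)) \<and> is_core t xs"
      using True p by (auto simp: is_core_def ball_cells_Cons hook_number_Cons_Suc)
    moreover have "x + length xs \<notin> {..<b}" if "b \<in> set (beta xs)" for b
      using beta_bound[OF le that] by simp
    ultimately show ?thesis
      using True p unfolding row0 Cons.IH by auto
  qed (auto simp: is_core_def)
qed

text \<open>On the way down in steps of \<open>t\<close> from an element of the beta-set to a gap, there is a first
  step that leaves the beta-set.\<close>

lemma is_core_iff_beta:
  assumes "t > 0"
  shows "is_core t xs \<longleftrightarrow>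
    is_partition xs \<and> (\<forall>b\<in>set (beta xs). t \<le> b \<longrightarrow> b - t \<in> set (beta xs))"
  unfolding is_core_iff_gaps
proof (intro conj_cong refl iffI ballI allI impI)
  fix b assume *: "\<forall>b\<in>set (beta xs). \<forall>c<b. c \<notin> set (beta xs) \<longrightarrow> \<not> t dvd b - c"
    and b: "b \<in> set (beta xs)" "t \<le> b"
  have "b - t < b" "b - (b - t) = t" using b assms by auto
  then show "b - t \<in> set (beta xs)" using * b by force
next
  fix b c assume *: "\<forall>b\<in>set (beta xs). t \<le> b \<longrightarrow> b - t \<in> set (beta xs)"
    and b: "b \<in> set (beta xs)" "c < b" "c \<notin> set (beta xs)"
  have "t * k \<le> b \<Longrightarrow> b - t * k \<in> set (beta xs)" for k
  proof (induction k)
    case (Suc k)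
    then have "b - t * k \<in> set (beta xs)" "t \<le> b - t * k" by auto
    with * have "b - t * k - t \<in> set (beta xs)" by blast
    then show ?case by (simp add: add.commute)
  qed (use b in simp)
  then show "\<not> t dvd b - c" using b by (metis diff_diff_cancel diff_le_self dvd_def less_imp_le)
qed

lemma beta_surj:
  assumes "finite S" "0 \<notin> S"
  shows "\<exists>xs. is_partition xs \<and> set (beta xs) = S"
  using assms
proof (induction S rule: finite_linorder_max_induct)
  case empty
  show ?case by (rule exI[of _ "[]"]) simp
next
  case (insert b S)
  then obtain xs where xs: "is_partition xs" "set (beta xs) = S" by auto
  have "length xs < b \<and> (\<forall>y\<in>set xs. y \<le> b - length xs)"
  proof (cases xs)
    case (Cons y ys)
    then have "y + length ys < b" using xs(2) insert.hyps by auto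
    then show ?thesis using xs(1) Cons by (force simp: is_partition_Cons)
  qed (use insert.prems in auto)
  then have "is_partition ((b - length xs) # xs) \<and> set (beta ((b - length xs) # xs)) = insert b S"
    using xs by (auto simp: is_partition_Cons)
  then show ?case by blast
qed

lemma beta_inj: "beta xs = beta ys \<Longrightarrow> xs = ys"
proof (induction xs arbitrary: ys)
  case Nil
  then show ?case by (cases ys) auto
next
  case (Cons x xs)
  then obtain y ys' where ys: "ys = y # ys'" "beta xs = beta ys'" by (cases ys) auto
  then have "xs = ys'" using Cons.IH by blast
  then show ?case using Cons.prems ys by simp
qed

lemma beta_set_inj:
  assumes "is_partition xs" "is_partition ys" "set (beta xs) = set (beta ys)"
  shows "xs = ys"
proof -
  have "rev (beta xs) = rev (beta ys)"
    using assms by (intro strict_sorted_equal) (simp_all add: sorted_wrt_rev beta_decreasing)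
  then show ?thesis by (simp add: beta_inj)
qed

lemma sum_beta:
  assumes "is_partition xs"
  shows "2 * int (\<Sum>(set (beta xs))) =
           2 * int (sum_list xs) + int (length xs) * (int (length xs) - 1)"
proof -
  have "2 * int (sum_list (beta xs)) =
          2 * int (sum_list xs) + int (length xs) * (int (length xs) - 1)" for xs
    by (induction xs) (auto simp: algebra_simps)
  moreover have "sum_list (beta xs) = \<Sum>(set (beta xs))"
    using distinct_beta[OF assms] by (rule distinct_sum_list_conv_Sum)
  ultimately show ?thesis by metis
qed

section \<open>The 3-cores as points of a quadrant\<close>

text \<open>The number $3 h + 1$ for $h = a^2 - ab + b^2 + b$ is the norm of the Eisenstein integer
  $1 - \sqrt{-3}\,(a + b\omega)$, which explains the symmetry of order 3 used below.\<close>

definition hexform :: "int \<Rightarrow> int \<Rightarrow> int" where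
  "hexform a b = a * a - a * b + b * b + b"

text \<open>The abacus with three runners: \<open>a\<close> beads on runner 1 and \<open>b\<close> beads on runner 2, all
  pushed up. Runner 0 is empty because beta-numbers are positive.\<close>

definition runners :: "nat \<times> nat \<Rightarrow> nat set" where
  "runners = (\<lambda>(a, b). (\<lambda>i. 3 * i + 1) ` {..<a} \<union> (\<lambda>i. 3 * i + 2) ` {..<b})"

lemma mem_runners:
  "3 * i \<notin> runners (a, b)" "3 * i + 1 \<in> runners (a, b) \<longleftrightarrow> i < a"
  "3 * i + 2 \<in> runners (a, b) \<longleftrightarrow> i < b"
proof -
  have "3 * i \<noteq> 3 * k + 1" "3 * i \<noteq> 3 * k + 2" "3 * i + 1 \<noteq> 3 * k + 2" "3 * i + 2 \<noteq> 3 * k + 1"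
    for k :: nat by presburger+
  then show "3 * i \<notin> runners (a, b)" "3 * i + 1 \<in> runners (a, b) \<longleftrightarrow> i < a"
    "3 * i + 2 \<in> runners (a, b) \<longleftrightarrow> i < b"
    unfolding runners_def by (auto simp del: One_nat_def add_2_eq_Suc' add_Suc_right)
qed

lemma residue_cases_3:
  obtains i where "s = 3 * i" | i where "s = 3 * i + 1" | i where "s = 3 * i + (2::nat)"
proof -
  have "s = 3 * (s div 3) \<or> s = 3 * (s div 3) + 1 \<or> s = 3 * (s div 3) + 2" by presburger
  then show ?thesis using that by metis
qed

lemma card_sum_runners:
  "finite (runners (a, b))" "0 \<notin> runners (a, b)" "card (runners (a, b)) = a + b"
  "2 * int (\<Sum>(runners (a, b))) = a * (3 * int a - 1) + b * (3 * int b + 1)"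
proof -
  define A where "A = (\<lambda>i::nat. 3 * i + 1) ` {..<a}"
  define B where "B = (\<lambda>i::nat. 3 * i + 2) ` {..<b}"
  have AB: "runners (a, b) = A \<union> B" by (simp add: runners_def A_def B_def)
  have fin: "finite A" "finite B" by (simp_all add: A_def B_def)
  have inj: "inj_on (\<lambda>i::nat. 3 * i + 1) I" "inj_on (\<lambda>i::nat. 3 * i + 2) I" for I
    by (auto simp: inj_on_def)
  have card: "card A = a" "card B = b"
    unfolding A_def B_def by (simp_all only: card_image[OF inj(1)] card_image[OF inj(2)]
      card_lessThan)
  have "3 * i + 1 \<noteq> 3 * k + 2" for i k :: nat by presburger
  then have disj: "A \<inter> B = {}" unfolding A_def B_def by blast
  show "finite (runners (a, b))" "0 \<notin> runners (a, b)" "card (runners (a, b)) = a + b"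
    using fin disj mem_runners(1)[of 0 a b] by (simp_all add: AB card card_Un_disjoint)
  have "2 * int (\<Sum>A) = a * (3 * int a - 1)"
    unfolding A_def sum.reindex[OF inj(1)] by (induction a) (auto simp: algebra_simps)
  moreover have "2 * int (\<Sum>B) = b * (3 * int b + 1)"
    unfolding B_def sum.reindex[OF inj(2)] by (induction b) (auto simp: algebra_simps)
  ultimately show "2 * int (\<Sum>(runners (a, b))) = a * (3 * int a - 1) + b * (3 * int b + 1)"
    unfolding AB sum.union_disjoint[OF fin disj] by simp
qed

lemma closed_set_runners:
  fixes S :: "nat set"
  assumes "finite S" "0 \<notin> S" and closed: "\<And>s. s \<in> S \<Longrightarrow> 3 \<le> s \<Longrightarrow> s - 3 \<in> S"
  shows "S \<in> range runners"
proof -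
  have run: "\<exists>a. \<forall>i. 3 * i + r \<in> S \<longleftrightarrow> i < a" for r
  proof -
    have fin: "finite {i. 3 * i + r \<in> S}"
      using finite_vimageI[OF assms(1), of "\<lambda>i. 3 * i + r"] by (simp add: inj_on_def vimage_def)
    obtain a where a: "3 * a + r \<notin> S" "\<And>i. i < a \<Longrightarrow> 3 * i + r \<in> S"
    proof -
      have ex: "\<exists>i. 3 * i + r \<notin> S"
        using fin by (metis (mono_tags, lifting) UNIV_eq_I infinite_UNIV_nat mem_Collect_eq)
      show ?thesis
        by (rule that[of "LEAST i. 3 * i + r \<notin> S"]) (use LeastI_ex[OF ex] not_less_Least in blast)+
    qed
    have "3 * i + r \<notin> S" if "i \<ge> a" for i
      using that
    proof (induction i rule: dec_induct)
      case (step i)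
      then show ?case using closed[of "3 * Suc i + r"] by auto
    qed (use a in simp)
    then show ?thesis using a(2) by (metis not_le)
  qed
  from run[of 1] run[of 2] obtain a b where
    ab: "\<And>i. 3 * i + 1 \<in> S \<longleftrightarrow> i < a" "\<And>i. 3 * i + 2 \<in> S \<longleftrightarrow> i < b" by metis
  have zero: "3 * i \<notin> S" for i
  proof (induction i)
    case (Suc i)
    then show ?case using closed[of "3 * Suc i"] by auto
  qed (use assms in simp)
  have "S = runners (a, b)"
  proof (rule set_eqI)
    fix s
    show "s \<in> S \<longleftrightarrow> s \<in> runners (a, b)"
      by (cases s rule: residue_cases_3) (simp_all only: ab zero mem_runners simp_thms)
  qed
  then show ?thesis by blast
qed

lemma runners_closed:
  assumes "s \<in> runners (a, b)" "3 \<le> s"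
  shows "s - 3 \<in> runners (a, b)"
proof -
  define u where "u = s - 3"
  have s: "s = u + 3" using assms(2) by (simp add: u_def)
  have "u \<in> runners (a, b)"
  proof (cases u rule: residue_cases_3)
    case (1 i)
    then show ?thesis using assms(1) mem_runners(1)[of "Suc i" a b] by (simp add: s add.commute)
  next
    case (2 i)
    then have "s = 3 * Suc i + 1" by (simp add: s)
    then show ?thesis using assms(1) unfolding 2 by (simp only: mem_runners)
  next
    case (3 i)
    then have "s = 3 * Suc i + 2" by (simp add: s)
    then show ?thesis using assms(1) unfolding 3 by (simp only: mem_runners)
  qed
  then show ?thesis by (simp add: u_def)
qed

lemma inj_runners: "inj runners"
proof (rule injI, clarify)
  fix a b c d assume eq: "runners (a, b) = runners (c, d)"
  have "i < a \<longleftrightarrow> i < c" "i < b \<longleftrightarrow> i < d" for i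
    using eq mem_runners by metis+
  then show "a = c \<and> b = d" by (metis less_irrefl linorder_neqE_nat)
qed

text \<open>With $l = a + b$ parts, the size is the sum of the beta-set minus $0 + 1 + \dots + (l -
  1)$, which evaluates to \<open>hexform\<close>.\<close>

lemma card_3_cores:
  "card {xs. is_core 3 xs \<and> sum_list xs = n} = card {(a, b). hexform (int a) (int b) = int n}"
proof -
  define h where "h xs = (SOME ab. runners ab = set (beta xs))" for xs
  have h: "runners (h xs) = set (beta xs)" if "is_core 3 xs" for xs
  proof -
    have "set (beta xs) \<in> range runners"
      using that by (intro closed_set_runners) (auto simp: is_core_iff_beta dest: beta_pos)
    then show ?thesis unfolding h_def by (metis (mono_tags, lifting) imageE someI_ex)
  qed
  have size: "int (sum_list xs) = hexform (int a) (int b)"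
    if "is_partition xs" "set (beta xs) = runners (a, b)" for xs a b
  proof -
    have "length xs = a + b"
      using distinct_card[OF distinct_beta[OF that(1)]] that(2) card_sum_runners(3)[of a b] by simp
    then show ?thesis
      using sum_beta[OF that(1)] card_sum_runners(4)[of a b] that(2)
      by (simp add: hexform_def algebra_simps)
  qed
  have "bij_betw h {xs. is_core 3 xs \<and> sum_list xs = n} {(a, b). hexform (int a) (int b) = int n}"
  proof (rule bij_betw_imageI)
    show "inj_on h {xs. is_core 3 xs \<and> sum_list xs = n}"
      using h by (auto intro!: inj_onI beta_set_inj simp: is_core_iff_beta) metis+
    show "h ` {xs. is_core 3 xs \<and> sum_list xs = n} = {(a, b). hexform (int a) (int b) = int n}"
    proof safe
      fix xs a b assume "is_core 3 xs" "n = sum_list xs" "(a, b) = h xs"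
      then show "hexform (int a) (int b) = int (sum_list xs)"
        using size[of xs a b] h[of xs] by (simp add: is_core_iff_beta)
    next
      fix a b assume *: "hexform (int a) (int b) = int n"
      obtain xs where xs: "is_partition xs" "set (beta xs) = runners (a, b)"
        using beta_surj card_sum_runners by metis
      then have core: "is_core 3 xs"
        using runners_closed by (auto simp: is_core_iff_beta)
      then have "h xs = (a, b)" using h xs inj_runners by (metis injD)
      moreover have "sum_list xs = n" using size[OF xs] * by simp
      ultimately show "(a, b) \<in> h ` {xs. is_core 3 xs \<and> sum_list xs = n}"
        using core by (metis (mono_tags, lifting) imageI mem_Collect_eq)
    qed
  qed
  then show ?thesis by (rule bij_betw_same_card)
qed

section \<open>Infinite products of power series\<close>

text \<open>Congruence modulo $q^M$. Infinite products and sums are compared through their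
  truncations: two series that agree to every order are equal.\<close>

definition agree :: "nat \<Rightarrow> rat fps \<Rightarrow> rat fps \<Rightarrow> bool" where
  "agree M F G \<longleftrightarrow> (\<forall>i<M. fps_nth F i = fps_nth G i)"

lemma agree_refl [simp]: "agree M F F" by (simp add: agree_def)

lemma agree_sym: "agree M F G \<Longrightarrow> agree M G F" by (simp add: agree_def)

lemma agree_trans [trans]: "agree M F G \<Longrightarrow> agree M G H \<Longrightarrow> agree M F H"
  by (simp add: agree_def)

lemma agree_imp_eq: "(\<And>M. agree M F G) \<Longrightarrow> F = G"
  by (auto simp: agree_def fps_eq_iff)

lemma agree_mult: "agree M F G \<Longrightarrow> agree M F' G' \<Longrightarrow> agree M (F * F') (G * G')"
  by (auto simp: agree_def fps_mult_nth intro!: sum.cong)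

lemma agree_add: "agree M F G \<Longrightarrow> agree M F' G' \<Longrightarrow> agree M (F + F') (G + G')"
  by (simp add: agree_def)

lemma agree_sum: "(\<And>x. x \<in> A \<Longrightarrow> agree M (F x) (G x)) \<Longrightarrow> agree M (sum F A) (sum G A)"
  by (auto simp: agree_def fps_sum_nth intro!: sum.cong)

lemma agree_X_power: "M \<le> e \<Longrightarrow> agree M (F * fps_X ^ e) 0"
  by (auto simp: agree_def fps_X_power_mult_right_nth)

lemma agree_cancel:
  assumes "agree M (F * U) (G * U)" "fps_nth U 0 \<noteq> 0"
  shows "agree M F G"
proof -
  have "agree M (F * U * inverse U) (G * U * inverse U)"
    using assms(1) by (rule agree_mult) simp
  moreover have "U * inverse U = 1" using assms(2) by (rule inverse_mult_eq_1')
  ultimately show ?thesis by (simp add: mult.assoc)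
qed

text \<open>The product $\prod_{m \ge 0} (1 - c\,q^{i + mN})$, that is $(c q^i; q^N)_\infty$. For $N
  > 0$ the coefficient of $q^n$ is already correct in the partial product used.\<close>

definition qprod :: "rat \<Rightarrow> nat \<Rightarrow> nat \<Rightarrow> rat fps" where
  "qprod c i N =
     Abs_fps (\<lambda>n. fps_nth (\<Prod>m<Suc n. 1 - fps_const c * fps_X ^ (i + m * N)) n)"

lemma agree_qprod:
  assumes "N > 0" "M \<le> i + n * N"
  shows "agree M (\<Prod>m<n. 1 - fps_const c * fps_X ^ (i + m * N)) (qprod c i N)"
proof -
  define P where "P n = (\<Prod>m<n. 1 - fps_const c * fps_X ^ (i + m * N))" for n
  have step: "agree L (P (n + d)) (P n)" if "L \<le> i + n * N" for L n d
  proof (induction d)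
    case (Suc d)
    have "L \<le> i + (n + d) * N" using that by (simp add: distrib_right)
    then have "agree L (P (n + d) + (- P (n + d) * fps_const c) * fps_X ^ (i + (n +
      d) * N)) (P (n + d) + 0)"
      by (intro agree_add agree_X_power) auto
    moreover have "P (n + Suc d) =
        P (n + d) + (- P (n + d) * fps_const c) * fps_X ^ (i + (n + d) * N)"
      by (simp add: P_def algebra_simps)
    ultimately show ?case using Suc agree_trans by simp
  qed simp
  have step': "agree L (P n) (P n')" if "L \<le> i + n * N" "L \<le> i + n' * N" for L n n'
    using step[OF that(1), of "n' - n"] step[OF that(2), of "n - n'"]
    by (cases "n \<le> n'") (auto intro: agree_sym)
  show ?thesis
    unfolding agree_def P_def[symmetric]
  proof (intro allI impI)
    fix t assume "t < M"
    moreover have "Suc t \<le> Suc t * N" using \<open>N > 0\<close> by (cases N) auto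
    ultimately have "agree (Suc t) (P n) (P (Suc t))"
      using assms by (intro step') auto
    then show "fps_nth (P n) t = fps_nth (qprod c i N) t"
      by (simp add: agree_def qprod_def P_def)
  qed
qed

lemma f_eq_qprod:
  assumes "k > 0"
  shows "f k = qprod 1 k k"
proof -
  have "f k \<noteq> 0" using f_has_prod(2)[OF assms] by auto
  then have "(\<lambda>n. \<Prod>m\<le>n. 1 - fps_X ^ (k * Suc m)) \<longlonglongrightarrow> f k"
    using f_has_prod(1)[OF assms] by (simp add: has_prod_def raw_has_prod_def)
  then have lim: "eventually (\<lambda>n. fps_nth (\<Prod>m\<le>n. 1 - fps_X ^ (k * Suc m)) t =
    fps_nth (f k) t) sequentially"
    for t unfolding tendsto_fps_iff by blast
  show ?thesis
  proof (rule fps_ext)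
    fix t
    obtain n where n: "n \<ge> t" "fps_nth (\<Prod>m\<le>n. 1 - fps_X ^ (k * Suc m)) t = fps_nth (f k) t"
      using eventually_conj[OF lim eventually_ge_at_top[of t]] eventually_happens[of _ sequentially]
      by force
    have "Suc n \<le> Suc n * k" using assms by (cases k) auto
    then have "Suc t \<le> k + Suc n * k" using n(1) by linarith
    then have "agree (Suc t) (\<Prod>m<Suc n. 1 - fps_const 1 * fps_X ^ (k + m * k)) (qprod 1 k k)"
      by (rule agree_qprod[OF assms])
    then show "fps_nth (f k) t = fps_nth (qprod 1 k k) t"
      unfolding n(2)[symmetric] by (simp add: agree_def lessThan_Suc_atMost mult.commute)
  qed
qed

lemma prod_split_2: "(\<Prod>m<2 * n. g m) = (\<Prod>m<n. g (2 * m)) * (\<Prod>m<n. g (2 * m + 1))"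
  for g :: "nat \<Rightarrow> 'a::comm_monoid_mult"
  by (induction n) (auto simp: ac_simps)

lemma prod_split_3:
  "(\<Prod>m<3 * n. g m) = (\<Prod>m<n. g (3 * m)) * (\<Prod>m<n. g (3 * m + 1)) * (\<Prod>m<n. g (3 * m + 2))"
  for g :: "nat \<Rightarrow> 'a::comm_monoid_mult"
  by (induction n) (auto simp: ac_simps numeral_3_eq_3)

lemma agree_qprod_self: "N > 0 \<Longrightarrow> agree n (\<Prod>m<n. 1 - fps_const c * fps_X ^ (i +
  m * N)) (qprod c i N)"
  by (rule agree_qprod) (auto intro: trans_le_add2)

lemma qprod_split_2:
  assumes "N > 0"
  shows "qprod c i N = qprod c i (2 * N) * qprod c (i + N) (2 * N)"
proof (rule agree_imp_eq)
  fix M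
  have "agree M (qprod c i N) (\<Prod>m<2 * M. 1 - fps_const c * fps_X ^ (i + m * N))"
    using assms by (intro agree_sym[OF agree_qprod]) (auto intro: trans_le_add2)
  also have "(\<Prod>m<2 * M. 1 - fps_const c * fps_X ^ (i + m * N)) =
      (\<Prod>m<M. 1 - fps_const c * fps_X ^ (i + m * (2 * N))) *
      (\<Prod>m<M. 1 - fps_const c * fps_X ^ (i + N + m * (2 * N)))"
  proof -
    have "i + 2 * m * N = i + m * (2 * N)" "i + (2 * m + 1) * N = i + N + m * (2 * N)" for m
      by (simp_all add: algebra_simps)
    then show ?thesis unfolding prod_split_2 by (simp only:)
  qed
  also have "agree M \<dots> (qprod c i (2 * N) * qprod c (i + N) (2 * N))"
    using assms by (intro agree_mult agree_qprod_self) auto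
  finally show "agree M (qprod c i N) (qprod c i (2 * N) * qprod c (i + N) (2 * N))" .
qed

lemma qprod_split_3:
  assumes "N > 0"
  shows "qprod c i N = qprod c i (3 * N) * qprod c (i + N) (3 * N) * qprod c (i + 2 * N) (3 * N)"
proof (rule agree_imp_eq)
  fix M
  have "agree M (qprod c i N) (\<Prod>m<3 * M. 1 - fps_const c * fps_X ^ (i + m * N))"
    using assms by (intro agree_sym[OF agree_qprod]) (auto intro: trans_le_add2)
  also have "(\<Prod>m<3 * M. 1 - fps_const c * fps_X ^ (i + m * N)) =
      (\<Prod>m<M. 1 - fps_const c * fps_X ^ (i + m * (3 * N))) *
      (\<Prod>m<M. 1 - fps_const c * fps_X ^ (i + N + m * (3 * N))) *
      (\<Prod>m<M. 1 - fps_const c * fps_X ^ (i + 2 * N + m * (3 * N)))"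
  proof -
    have "i + 3 * m * N = i + m * (3 * N)" "i + (3 * m + 1) * N = i + N + m * (3 * N)"
      "i + (3 * m + 2) * N = i + 2 * N + m * (3 * N)" for m by (simp_all add: algebra_simps)
    then show ?thesis unfolding prod_split_3 by (simp only:)
  qed
  also have "agree M \<dots>
      (qprod c i (3 * N) * qprod c (i + N) (3 * N) * qprod c (i + 2 * N) (3 * N))"
    using assms by (intro agree_mult agree_qprod_self) auto
  finally show "agree M (qprod c i N)
      (qprod c i (3 * N) * qprod c (i + N) (3 * N) * qprod c (i + 2 * N) (3 * N))" .
qed

lemma qprod_mult_neg:
  assumes "N > 0"
  shows "qprod (-1) i N * qprod 1 i N = qprod 1 (2 * i) (2 * N)"
proof (rule agree_imp_eq)
  fix M
  define A B where "A = (\<Prod>m<M. 1 - fps_const (-1 :: rat) * fps_X ^ (i + m * N))"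
    and "B = (\<Prod>m<M. 1 - fps_const (1 :: rat) * fps_X ^ (i + m * N))"
  have eq: "A * B = (\<Prod>m<M. 1 - fps_const 1 * fps_X ^ (2 * i + m * (2 * N)))"
  proof -
    have "(1 - fps_const (-1) * fps_X ^ (i + m * N)) * (1 - fps_const 1 * fps_X ^ (i + m * N)) =
        1 - fps_const 1 * (fps_X :: rat fps) ^ (2 * i + m * (2 * N))" for m
    proof -
      define Y where "Y = (fps_X :: rat fps) ^ (i + m * N)"
      have "2 * i + m * (2 * N) = (i + m * N) + (i + m * N)" by simp
      then have Y2: "fps_X ^ (2 * i + m * (2 * N)) = Y * Y"
        unfolding Y_def by (simp only: power_add)
      show ?thesis
        unfolding Y2 Y_def[symmetric] by (simp add: algebra_simps flip: fps_const_neg)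
    qed
    then show ?thesis unfolding A_def B_def by (subst prod.distrib[symmetric])
      (rule prod.cong[OF refl])
  qed
  have "agree M (qprod (-1) i N * qprod 1 i N) (A * B)"
    unfolding A_def B_def by (intro agree_sym[OF agree_mult] agree_qprod_self assms)
  also note eq
  also have "agree M (\<Prod>m<M. 1 - fps_const 1 * fps_X ^ (2 * i +
    m * (2 * N))) (qprod 1 (2 * i) (2 * N))"
    using assms by (intro agree_qprod_self) simp
  finally show "agree M (qprod (-1) i N * qprod 1 i N) (qprod 1 (2 * i) (2 * N))" .
qed

lemma qprod_0:
  assumes "N > 0"
  shows "qprod c 0 N = fps_const (1 - c) * qprod c N N"
proof (rule agree_imp_eq)
  fix M
  define A where "A = (\<Prod>m<M. 1 - fps_const c * fps_X ^ (N + m * N))"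
  have "M \<le> 0 + Suc M * N" using assms by (cases N) auto
  with assms have "agree M (\<Prod>m<Suc M. 1 - fps_const c * fps_X ^ (0 + m * N)) (qprod c 0 N)"
    by (rule agree_qprod)
  then have "agree M (qprod c 0 N) (\<Prod>m<Suc M. 1 - fps_const c * fps_X ^ (0 + m * N))"
    by (rule agree_sym)
  also have "(\<Prod>m<Suc M. 1 - fps_const c * fps_X ^ (0 + m * N)) = fps_const (1 - c) * A"
  proof -
    have "1 - fps_const c = fps_const (1 - c)" by (simp flip: fps_const_sub)
    then show ?thesis unfolding prod.lessThan_Suc_shift A_def by simp
  qed
  also have "agree M (fps_const (1 - c) * A) (fps_const (1 - c) * qprod c N N)"
    unfolding A_def by (intro agree_mult agree_qprod_self assms agree_refl)
  finally show "agree M (qprod c 0 N) (fps_const (1 - c) * qprod c N N)" .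
qed

section \<open>The q-binomial theorem\<close>

fun qbinom :: "'a::comm_ring_1 \<Rightarrow> nat \<Rightarrow> nat \<Rightarrow> 'a" where
  "qbinom Q n 0 = 1"
| "qbinom Q 0 (Suc k) = 0"
| "qbinom Q (Suc n) (Suc k) = qbinom Q n k + Q ^ Suc k * qbinom Q n (Suc k)"

lemma qbinom_eq_0: "n < k \<Longrightarrow> qbinom Q n k = 0"
  by (induction Q n k rule: qbinom.induct) auto

text \<open>The induction removes the factor with \<open>m = 0\<close>; the remaining product is the same one
  with \<open>y * Q\<close> in place of \<open>y\<close>, which is why \<open>y\<close> must be arbitrary. The version with two
  variables avoids negative powers in the triple product below.\<close>

theorem q_binomial:
  fixes x y Q :: "'a::comm_ring_1"
  shows "(\<Prod>m<n. x + y * Q ^ m) = (\<Sum>k\<le>n. Q ^ (\<Sum>{..<k}) * qbinom Q n k * y ^ k * x ^ (n - k))"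
proof (induction n arbitrary: y)
  case (Suc n)
  define T where "T k = Q ^ (\<Sum>{..<k}) * qbinom Q n k * (y * Q) ^ k * x ^ (n - k)" for k
  define U where "U k = Q ^ (\<Sum>{..<k}) * y ^ k" for k
  have U: "U (Suc k) = U k * Q ^ k * y" "T k = U k * Q ^ k * qbinom Q n k * x ^ (n - k)" for k
    by (simp_all add: U_def T_def power_mult_distrib power_add mult_ac)
  have "(\<Prod>m<Suc n. x + y * Q ^ m) = (x + y) * (\<Prod>m<n. x + (y * Q) * Q ^ m)"
    unfolding prod.lessThan_Suc_shift by (simp add: mult.assoc)
  also have "\<dots> = x * (\<Sum>k\<le>n. T k) + y * (\<Sum>k\<le>n. T k)"
    unfolding Suc.IH T_def by (rule distrib_right)
  also have "x * (\<Sum>k\<le>n. T k) = (\<Sum>k\<le>n. U k * Q ^ k * qbinom Q n k * x ^ (Suc n - k))"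
    unfolding sum_distrib_left by (rule sum.cong) (auto simp: U(2) Suc_diff_le mult_ac)
  also have "\<dots> = (\<Sum>k\<le>Suc n. U k * Q ^ k * qbinom Q n k * x ^ (Suc n - k))"
    by (simp add: qbinom_eq_0)
  also have "\<dots> = x ^ Suc n + (\<Sum>k\<le>n. U (Suc k) * (Q ^ Suc k * qbinom Q n (Suc k)) * x ^ (n - k))"
    unfolding sum.atMost_Suc_shift by (simp add: U_def mult.assoc)
  also have "y * (\<Sum>k\<le>n. T k) = (\<Sum>k\<le>n. U (Suc k) * qbinom Q n k * x ^ (n - k))"
    unfolding sum_distrib_left by (rule sum.cong) (simp_all add: U mult_ac)
  finally have "(\<Prod>m<Suc n. x + y * Q ^ m) =
      x ^ Suc n + (\<Sum>k\<le>n. U (Suc k) * (Q ^ Suc k * qbinom Q n (Suc k)) * x ^ (n - k)) +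
      (\<Sum>k\<le>n. U (Suc k) * qbinom Q n k * x ^ (n - k))" .
  also have "\<dots> = x ^ Suc n + (\<Sum>k\<le>n. U (Suc k) * qbinom Q (Suc n) (Suc k) * x ^ (n - k))"
    unfolding add.assoc sum.distrib[symmetric]
    by (simp only: qbinom.simps distrib_left distrib_right add.commute)
  also have "\<dots> = (\<Sum>k\<le>Suc n. U k * qbinom Q (Suc n) k * x ^ (Suc n - k))"
    unfolding sum.atMost_Suc_shift by (simp add: U_def del: qbinom.simps(3))
  also have "\<dots> = (\<Sum>k\<le>Suc n. Q ^ (\<Sum>{..<k}) * qbinom Q (Suc n) k * y ^ k * x ^ (Suc n - k))"
    by (rule sum.cong) (simp_all add: U_def mult_ac del: qbinom.simps)
  finally show ?case .
qed simp

definition qfact :: "'a::comm_ring_1 \<Rightarrow> nat \<Rightarrow> 'a" where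
  "qfact Q n = (\<Prod>m<n. 1 - Q ^ Suc m)"

lemma qbinom_qfact: "k \<le> n \<Longrightarrow> qbinom Q n k * qfact Q k * qfact Q (n - k) = qfact Q n"
proof (induction Q n k rule: qbinom.induct)
  case (3 Q n k)
  show ?case
  proof (cases "k = n")
    case True
    then show ?thesis using 3 by (simp add: qbinom_eq_0 qfact_def algebra_simps)
  next
    case False
    then obtain d where n: "n = Suc (k + d)" using "3.prems" by
      (metis Suc_le_mono le_neq_implies_less less_imp_Suc_add)
    have 1: "qbinom Q n k * qfact Q k * qfact Q (Suc d) = qfact Q n"
      and 2: "qbinom Q n (Suc k) * qfact Q (Suc k) * qfact Q d = qfact Q n"
      using "3.IH" by (simp_all add: n)
    have suc: "qfact Q (Suc m) = qfact Q m * (1 - Q ^ Suc m)" for m by (simp add: qfact_def)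
    have "qbinom Q (Suc n) (Suc k) * qfact Q (Suc k) * qfact Q (Suc n - Suc k) =
        (qbinom Q n k * qfact Q k * qfact Q (Suc d)) * (1 - Q ^ Suc k) +
        (qbinom Q n (Suc k) * qfact Q (Suc k) * qfact Q d) * (Q ^ Suc k * (1 - Q ^ Suc d))"
      by (simp add: n suc algebra_simps)
    also have "\<dots> = qfact Q n * (1 - Q ^ Suc k * Q ^ Suc d)"
      unfolding 1 2 by (simp add: algebra_simps)
    also have "Q ^ Suc k * Q ^ Suc d = Q ^ Suc n" unfolding n by
      (simp flip: power_add add: algebra_simps)
    finally show ?thesis by (simp add: suc)
  qed
qed (auto simp: qfact_def)

lemma agree_qfact:
  assumes "N > 0" "M \<le> m"
  shows "agree M (qfact (fps_X ^ N) m) (f N)"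
proof -
  have "m \<le> m * N" using assms(1) by (cases N) auto
  then have "agree M (\<Prod>m<m. 1 - fps_const 1 * fps_X ^ (N + m * N)) (qprod 1 N N)"
    using assms by (intro agree_qprod) linarith+
  then show ?thesis
    using assms(1) by (simp add: qfact_def f_eq_qprod mult.commute power_add flip: power_mult)
qed

text \<open>In the limit the Gaussian binomial coefficient $(Q)_n / ((Q)_k (Q)_{n-k})$ tends to
  $1/(Q)_\infty$ when both \<open>k\<close> and \<open>n - k\<close> tend to infinity.\<close>

lemma agree_qbinom:
  assumes "N > 0" "M \<le> k" "M + k \<le> n"
  shows "agree M (qbinom (fps_X ^ N) n k * f N) 1"
proof (rule agree_cancel[where U = "f N"])
  have "agree M (qbinom (fps_X ^ N) n k * f N * f N)
      (qbinom (fps_X ^ N) n k * qfact (fps_X ^ N) k * qfact (fps_X ^ N) (n - k))"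
    using assms by (intro agree_mult agree_sym[OF agree_qfact] agree_refl) auto
  also have "qbinom (fps_X ^ N) n k * qfact (fps_X ^ N) k * qfact (fps_X ^ N) (n - k) =
      qfact (fps_X ^ N) n" using assms by (intro qbinom_qfact) simp
  also have "agree M (qfact (fps_X ^ N) n) (1 * f N)"
    using assms by (simp add: agree_qfact)
  finally show "agree M (qbinom (fps_X ^ N) n k * f N * f N) (1 * f N)" .
qed (use assms f_has_prod(2) in simp)

section \<open>Generating series of sets with a statistic\<close>

text \<open>The series $\sum_{x \in A} w(x)\, q^{e(x)}$. It is defined by its coefficients, so it is
  meaningful when the statistic \<open>e\<close> is nonnegative with finite fibres on \<open>A\<close>. The statistic has
  integer values because quadratic forms on the integers are to be plugged in.\<close>

definition gen_series :: "('a \<Rightarrow> int) \<Rightarrow> ('a \<Rightarrow> rat) \<Rightarrow> 'a set \<Rightarrow> rat fps" where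
  "gen_series e w A = Abs_fps (\<lambda>n. \<Sum>x\<in>{x\<in>A. e x = int n}. w x)"

lemma agree_gen_series:
  assumes "finite W" "W \<subseteq> A" "\<And>x. x \<in> A \<Longrightarrow> 0 \<le> e x" "\<And>x. x \<in> A - W \<Longrightarrow> int M \<le> e x"
  shows "agree M (\<Sum>x\<in>W. fps_const (w x) * fps_X ^ nat (e x)) (gen_series e w A)"
  unfolding agree_def
proof (intro allI impI)
  fix n assume "n < M"
  then have eq: "{x\<in>A. e x = int n} = {x\<in>W. n = nat (e x)}"
    using assms by force
  show "fps_nth (\<Sum>x\<in>W. fps_const (w x) * fps_X ^ nat (e x)) n = fps_nth (gen_series e w A) n"
    using assms(1) by (simp add: fps_sum_nth gen_series_def eq sum.If_cases sum.inter_filter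
      if_distrib cong: if_cong)
qed

section \<open>Theta series and the triple product\<close>

definition tri :: "int \<Rightarrow> int" where "tri l = l * (l + 1) div 2"

lemma two_tri: "2 * tri l = l * (l + 1)"
  unfolding tri_def by (rule dvd_mult_div_cancel) simp

lemma tri_ge: "tri l \<ge> \<bar>l\<bar> - 1" "tri l \<ge> 0"
proof -
  have "(l - 1) * l \<ge> 0" "(l + 2) * (l + 1) \<ge> 0" "l * (l + 1) \<ge> 0"
    by (auto simp: zero_le_mult_iff)
  then show "tri l \<ge> \<bar>l\<bar> - 1" "tri l \<ge> 0"
    using two_tri[of l] by (auto simp: algebra_simps abs_if)
qed

text \<open>Equal to $i\,l(l+1)/2 + j\,l(l-1)/2$, the exponent in Ramanujan's theta function.\<close>

definition theta_exp :: "nat \<Rightarrow> nat \<Rightarrow> int \<Rightarrow> int" where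
  "theta_exp i j l = int i * tri l + int j * tri (l - 1)"

lemma theta_exp_ge:
  assumes "i > 0"
  shows "theta_exp i j l \<ge> \<bar>l\<bar> - 1" "theta_exp i j l \<ge> 0"
proof -
  have "int i * tri l \<ge> 1 * tri l" using assms tri_ge by (intro mult_right_mono) auto
  moreover have "int j * tri (l - 1) \<ge> 0" using tri_ge by simp
  ultimately show "theta_exp i j l \<ge> \<bar>l\<bar> - 1" "theta_exp i j l \<ge> 0"
    using tri_ge[of l] by (auto simp: theta_exp_def)
qed

text \<open>Ramanujan's theta function $f(c q^i, c q^j) = \sum_l c^l q^{i l(l+1)/2 + j l(l-1)/2}$.
  The exponent of \<open>c\<close> is taken as an absolute value, which makes no difference for $c = \pm 1$.\<close>

definition theta :: "rat \<Rightarrow> nat \<Rightarrow> nat \<Rightarrow> rat fps" where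
  "theta c i j = gen_series (theta_exp i j) (\<lambda>l. c ^ nat \<bar>l\<bar>) UNIV"

lemma two_sum_lessThan: "2 * int (\<Sum>{..<k}) = int k * (int k - 1)"
  by (induction k) (auto simp: algebra_simps)

lemma half_int_eq: "2 * int l = 2 * (int m + J) \<Longrightarrow> 0 \<le> J \<Longrightarrow> l = m + nat J"
  by arith

text \<open>This is the \<open>q\<close>-binomial theorem for the $2n$ factors $q^{Nn} + c q^i q^{Nm}$ with $N =
  i + j$, where $m < 2n$. A power of $q$ can be taken out of each factor: for $m \ge n$ this
  leaves the factors of the first product, and for $m < n$, in reverse order and up to the sign
  $c$, those of the second.\<close>

lemma finite_jacobi_triple:
  fixes c :: rat
  assumes c: "c * c = 1"
  shows "(\<Prod>m<n. 1 + fps_const c * fps_X ^ (i + m * (i + j))) *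
         (\<Prod>m<n. 1 + fps_const c * fps_X ^ (j + m * (i + j))) =
         (\<Sum>k\<le>2 * n. qbinom (fps_X ^ (i + j)) (2 * n) k *
            (fps_const (c ^ nat \<bar>int k - int n\<bar>) * fps_X ^ nat (theta_exp i j (int k - int n))))"
proof -
  define N where "N = i + j"
  define C where "C = (fps_const c :: rat fps)"
  have CC: "C * C = 1" using c by (simp add: C_def)
  define A where "A = (\<Prod>m<n. 1 + C * fps_X ^ (i + m * N))"
  define B where "B = (\<Prod>m<n. 1 + C * fps_X ^ (j + m * N))"
  \<comment> \<open>The power of $q$ taken out of all $2n$ factors together.\<close>
  define d where "d = i * n + N * \<Sum>{..<n} + N * n * n"
  have hi: "(\<Prod>m<n. fps_X ^ (N * n) + C * fps_X ^ i * (fps_X ^ N) ^ (n + m)) =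
    fps_X ^ (N * n * n) * A"
  proof -
    have "fps_X ^ (N * n) + C * fps_X ^ i * (fps_X ^ N) ^ (n + m) =
        fps_X ^ (N * n) * (1 + C * fps_X ^ (i + m * N))" for m
      by (simp add: algebra_simps flip: power_mult power_add)
    then show ?thesis by (simp add: A_def prod.distrib flip: power_mult)
  qed
  have lo: "(\<Prod>m<n. fps_X ^ (N * n) + C * fps_X ^ i * (fps_X ^ N) ^ m) =
      C ^ n * fps_X ^ (i * n + N * \<Sum>{..<n}) * B"
  proof -
    have "(\<Prod>m<n. fps_X ^ (N * n) + C * fps_X ^ i * (fps_X ^ N) ^ m) =
        (\<Prod>m<n. fps_X ^ (N * n) + C * fps_X ^ i * (fps_X ^ N) ^ (n - Suc m))"
      by (rule prod.nat_diff_reindex[symmetric])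
    also have "\<dots> = (\<Prod>m<n. C * fps_X ^ (i + N * (n - Suc m)) * (1 + C * fps_X ^ (j + m * N)))"
    proof (intro prod.cong refl)
      fix m assume "m \<in> {..<n}"
      then obtain r where r: "n = Suc (m + r)" by (auto dest: less_imp_Suc_add)
      have "fps_X ^ (N * n) = C * C * (fps_X :: rat fps) ^ (i + N * (n - Suc m) + (j + m * N))"
        unfolding CC by (simp add: r N_def algebra_simps)
      then show "fps_X ^ (N * n) + C * fps_X ^ i * (fps_X ^ N) ^ (n - Suc m) =
          C * fps_X ^ (i + N * (n - Suc m)) * (1 + C * fps_X ^ (j + m * N))"
        by (simp add: algebra_simps power_add flip: power_mult)
    qed
    also have "\<dots> = C ^ n * (\<Prod>m<n. fps_X ^ (i + N * (n - Suc m))) * B"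
      by (simp add: prod.distrib B_def)
    also have "(\<Prod>m<n. (fps_X::rat fps) ^ (i + N * (n - Suc m))) = (\<Prod>m<n. fps_X ^ (i + N * m))"
      by (rule prod.nat_diff_reindex)
    also have "\<dots> = fps_X ^ (i * n + N * \<Sum>{..<n})"
      by (simp add: sum.distrib flip: power_sum sum_distrib_left)
    finally show ?thesis .
  qed
  have "C ^ n * fps_X ^ d * (A * B) =
      (\<Prod>m<2 * n. fps_X ^ (N * n) + C * fps_X ^ i * (fps_X ^ N) ^ m)"
  proof -
    have "(\<Prod>m<n + p. g m) = (\<Prod>m<n. g m) * (\<Prod>m<p. g (n + m))" for g :: "nat \<Rightarrow> rat fps" and p
      by (induction p) (simp_all add: mult.assoc)
    then have "(\<Prod>m<2 * n. fps_X ^ (N * n) + C * fps_X ^ i * (fps_X ^ N) ^ m) =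
        C ^ n * fps_X ^ (i * n + N * \<Sum>{..<n}) * B * (fps_X ^ (N * n * n) * A)"
      unfolding mult_2 by (simp only: hi lo)
    then show ?thesis by (simp only: d_def power_add mult_ac)
  qed
  also have "\<dots> = (\<Sum>k\<le>2 * n. (fps_X ^ N) ^ (\<Sum>{..<k}) * qbinom (fps_X ^ N) (2 * n) k *
      (C * fps_X ^ i) ^ k * (fps_X ^ (N * n)) ^ (2 * n - k))"
    by (rule q_binomial)
  also have "\<dots> = (\<Sum>k\<le>2 * n. C ^ n * fps_X ^ d * (qbinom (fps_X ^ N) (2 * n) k *
      (C ^ nat \<bar>int k - int n\<bar> * fps_X ^ nat (theta_exp i j (int k - int n)))))"
  proof (intro sum.cong refl)
    fix k assume "k \<in> {..2 * n}"
    then have k: "k \<le> 2 * n" by simp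
    have jnn: "theta_exp i j (int k - int n) \<ge> 0"
      using tri_ge by (simp add: theta_exp_def)
    have arith: "2 * ((I + J) * sk + I * K + (I + J) * L * (2 * L - K)) =
        2 * (I * L + (I + J) * sn + (I + J) * L * L + (I * t1 + J * t2))"
      if "2 * sk = K * (K - 1)" "2 * sn = L * (L - 1)" "2 * t1 = (K - L) * (K - L + 1)"
        "2 * t2 = (K - L - 1) * (K - L - 1 + 1)" for I J K L sk sn t1 t2 :: int
      using that by algebra
    have eq: "2 * int (N * \<Sum>{..<k} + i * k + N * n * (2 * n - k)) =
        2 * (int d + theta_exp i j (int k - int n))"
      using arith[OF two_sum_lessThan[of k] two_sum_lessThan[of n] two_tri two_tri, of "int i"
        "int j"] k
      unfolding d_def theta_exp_def N_def by (simp only: of_nat_add of_nat_mult of_nat_diff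
        of_nat_numeral)
    have ex: "N * \<Sum>{..<k} + i * k + N * n * (2 * n - k) = d + nat (theta_exp i j (int k - int n))"
      by (rule half_int_eq[OF eq jnn])
    have Ck: "C ^ k = C ^ n * C ^ nat \<bar>int k - int n\<bar>"
    proof (cases "n \<le> k")
      case True
      then show ?thesis by (simp flip: power_add add: nat_diff_distrib)
    next
      case False
      then obtain r where "n = k + r" by (metis le_add_diff_inverse nat_le_linear)
      then show ?thesis by (simp add: power_add mult.assoc CC power_mult_distrib[symmetric])
    qed
    have Xk: "(fps_X ^ N) ^ (\<Sum>{..<k}) * (fps_X ^ i) ^ k * (fps_X ^ (N * n)) ^ (2 * n - k) =
        (fps_X :: rat fps) ^ d * fps_X ^ nat (theta_exp i j (int k - int n))"
      unfolding power_mult[symmetric] power_add[symmetric] ex ..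
    have "(fps_X ^ N) ^ (\<Sum>{..<k}) * qbinom (fps_X ^ N) (2 * n) k * (C * fps_X ^ i) ^ k *
        (fps_X ^ (N * n)) ^ (2 * n - k) =
        qbinom (fps_X ^ N) (2 * n) k * C ^ k *
        ((fps_X ^ N) ^ (\<Sum>{..<k}) * (fps_X ^ i) ^ k * (fps_X ^ (N * n)) ^ (2 * n - k))"
      by (simp only: power_mult_distrib mult_ac)
    then show "(fps_X ^ N) ^ (\<Sum>{..<k}) * qbinom (fps_X ^ N) (2 * n) k * (C * fps_X ^ i) ^ k *
        (fps_X ^ (N * n)) ^ (2 * n - k) = C ^ n * fps_X ^ d * (qbinom (fps_X ^ N) (2 * n) k *
        (C ^ nat \<bar>int k - int n\<bar> * fps_X ^ nat (theta_exp i j (int k - int n))))"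
      unfolding Xk Ck by (simp only: mult_ac)
  qed
  also have "\<dots> = C ^ n * fps_X ^ d * (\<Sum>k\<le>2 * n. qbinom (fps_X ^ N) (2 * n) k *
      (C ^ nat \<bar>int k - int n\<bar> * fps_X ^ nat (theta_exp i j (int k - int n))))"
    by (simp add: sum_distrib_left)
  finally have "C ^ n * fps_X ^ d * (A * B) = \<dots>" .
  moreover have "C \<noteq> 0" using CC by auto
  ultimately have "A * B = (\<Sum>k\<le>2 * n. qbinom (fps_X ^ N) (2 * n) k *
      (C ^ nat \<bar>int k - int n\<bar> * fps_X ^ nat (theta_exp i j (int k - int n))))" by simp
  then show ?thesis by (simp add: A_def B_def C_def N_def fps_const_power)
qed

text \<open>After multiplication by $f_{i+j}$ the \<open>q\<close>-binomial coefficients in the finite version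
  become 1 in the limit; those for which this fails are multiplied by high powers of $q$.\<close>

theorem jacobi_triple:
  assumes c: "c * c = 1" and i: "i > 0"
  shows "theta c i j = qprod (-c) i (i + j) * qprod (-c) j (i + j) * f (i + j)"
proof (rule agree_imp_eq)
  fix M :: nat
  \<comment> \<open>Enough factors for both indices of a binomial coefficient to be at least \<open>M\<close> whenever its
    term matters.\<close>
  define n where "n = 2 * M"
  define N where "N = i + j"
  have N: "N > 0" using i by (simp add: N_def)
  define T where "T l = fps_const (c ^ nat \<bar>l\<bar>) * (fps_X :: rat fps) ^ nat (theta_exp i j l)" for l
  have "agree M (qprod (-c) i N * qprod (-c) j N * f N) ((\<Prod>m<n. 1 - fps_const (-c) * fps_X ^ (i +
    m * N)) *
      (\<Prod>m<n. 1 - fps_const (-c) * fps_X ^ (j + m * N)) * f N)"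
    using N by (intro agree_mult agree_sym[OF agree_qprod] agree_refl) (auto simp: n_def
      intro: trans_le_add2)
  also have "(\<Prod>m<n. 1 - fps_const (-c) * fps_X ^ (i + m * N)) *
      (\<Prod>m<n. 1 - fps_const (-c) * fps_X ^ (j + m * N)) * f N =
      (\<Sum>k\<le>2 * n. qbinom (fps_X ^ N) (2 * n) k * T (int k - int n)) * f N"
    using finite_jacobi_triple[OF c, of i j n] by (simp add: N_def T_def flip: fps_const_neg)
  also have "\<dots> = (\<Sum>k\<le>2 * n. (qbinom (fps_X ^ N) (2 * n) k * f N) * T (int k - int n))"
    by (simp add: sum_distrib_left sum_distrib_right mult_ac)
  also have "agree M \<dots> (\<Sum>k\<le>2 * n. 1 * T (int k - int n))"
  proof (rule agree_sum)
    fix k assume "k \<in> {..2 * n}"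
    then have k: "k \<le> 2 * n" by simp
    show "agree M (qbinom (fps_X ^ N) (2 * n) k * f N * T (int k - int n)) (1 * T (int k - int n))"
    proof (cases "\<bar>int k - int n\<bar> \<le> int M")
      case True
      then have "M \<le> k" "M + k \<le> 2 * n" by (auto simp: n_def)
      then show ?thesis using N by (intro agree_mult agree_qbinom agree_refl)
    next
      case False
      then have "int M \<le> theta_exp i j (int k - int n)" using theta_exp_ge(1)[OF i, of "int k -
        int n" j] by linarith
      then have "M \<le> nat (theta_exp i j (int k - int n))" by linarith
      then have "agree M (F * T (int k - int n)) 0" for F
        unfolding T_def mult.assoc[symmetric] by (rule agree_X_power)
      then show ?thesis by (blast intro: agree_trans agree_sym)
    qed
  qed
  also have "(\<Sum>k\<le>2 * n. 1 * T (int k - int n)) = (\<Sum>l\<in>{-int n..int n}. T l)"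
    by (rule sum.reindex_bij_witness[of _ "\<lambda>l. nat (l + int n)" "\<lambda>k. int k - int n"]) auto
  also have "agree M \<dots> (theta c i j)"
    unfolding theta_def T_def
  proof (rule agree_gen_series)
    fix l assume "l \<in> UNIV - {- int n..int n}"
    then show "int M \<le> theta_exp i j l" using theta_exp_ge(1)[OF i, of l j] by (auto simp: n_def)
  qed (use theta_exp_ge[OF i] in auto)
  finally have th: "agree M (qprod (-c) i N * qprod (-c) j N * f N) (theta c i j)" .
  show "agree M (theta c i j) (qprod (-c) i (i + j) * qprod (-c) j (i + j) * f (i + j))"
    using agree_sym[OF th] by (simp only: N_def)
qed

lemma gen_series_reindex:
  assumes "bij_betw h A B" "\<And>x. x \<in> A \<Longrightarrow> e' (h x) = e x" "\<And>x. x \<in> A \<Longrightarrow> w' (h x) = w x"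
  shows "gen_series e w A = gen_series e' w' B"
proof (rule fps_ext)
  fix n
  have "bij_betw h {x\<in>A. e x = int n} {y\<in>B. e' y = int n}"
    using assms(1,2) by (force simp: bij_betw_def inj_on_def)
  then have "(\<Sum>x\<in>{x\<in>A. e x = int n}. w' (h x)) = (\<Sum>y\<in>{y\<in>B. e' y = int n}. w' y)"
    by (rule sum.reindex_bij_betw)
  then show "fps_nth (gen_series e w A) n = fps_nth (gen_series e' w' B) n"
    using assms(3) by (simp add: gen_series_def)
qed

lemma gen_series_Un:
  assumes "A \<inter> B = {}" "\<And>n. finite {x\<in>A. e x = int n}" "\<And>n. finite {x\<in>B. e x = int n}"
  shows "gen_series e w (A \<union> B) = gen_series e w A + gen_series e w B"
proof (rule fps_ext)
  fix n
  have "{x\<in>A \<union> B. e x = int n} = {x\<in>A. e x = int n} \<union> {x\<in>B. e x = int n}" by auto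
  moreover have "{x\<in>A. e x = int n} \<inter> {x\<in>B. e x = int n} = {}" using assms(1) by auto
  ultimately show "fps_nth (gen_series e w (A \<union> B)) n =
    fps_nth (gen_series e w A + gen_series e w B) n"
    using assms(2,3) by (simp add: gen_series_def sum.union_disjoint)
qed

lemma gen_series_mult:
  assumes nn: "\<And>x. x \<in> A \<Longrightarrow> e x \<ge> 0" "\<And>y. y \<in> B \<Longrightarrow> e' y \<ge> 0"
    and fin: "\<And>n. finite {x\<in>A. e x = int n}" "\<And>n. finite {y\<in>B. e' y = int n}"
  shows "gen_series e w A * gen_series e' w' B = gen_series (\<lambda>(x, y). e x +
    e' y) (\<lambda>(x, y). w x * w' y) (A \<times> B)"
proof (rule fps_ext)
  fix n
  define S where "S i = {x\<in>A. e x = int i} \<times> {y\<in>B. e' y = int (n - i)}" for i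
  have "fps_nth (gen_series e w A * gen_series e' w' B) n = (\<Sum>i=0..n. \<Sum>(x, y)\<in>S i. w x * w' y)"
    by (simp add: fps_mult_nth gen_series_def S_def sum_product sum.cartesian_product)
  also have "\<dots> = (\<Sum>(x, y)\<in>(\<Union>i\<in>{0..n}. S i). w x * w' y)"
  proof (rule sum.UNION_disjoint[symmetric])
    show "\<forall>i\<in>{0..n}. finite (S i)" unfolding S_def by (intro ballI finite_cartesian_product fin)
  qed (auto simp: S_def)
  also have "(\<Union>i\<in>{0..n}. S i) = {p\<in>A \<times> B. (\<lambda>(x, y). e x + e' y) p = int n}"
  proof safe
    fix x y assume xy: "x \<in> A" "y \<in> B" "e x + e' y = int n"
    then have "(x, y) \<in> S (nat (e x))" "nat (e x) \<in> {0..n}"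
      using nn(1)[of x] nn(2)[of y] by (auto simp: S_def)
    then show "(x, y) \<in> (\<Union>i\<in>{0..n}. S i)" by blast
  qed (auto simp: S_def)
  finally show "fps_nth (gen_series e w A * gen_series e' w' B) n =
      fps_nth (gen_series (\<lambda>(x, y). e x + e' y) (\<lambda>(x, y). w x * w' y) (A \<times> B)) n"
    by (simp add: gen_series_def)
qed

definition dilate :: "nat \<Rightarrow> rat fps \<Rightarrow> rat fps" where
  "dilate k F = F oo fps_X ^ k"

lemma dilate_nth:
  assumes "k > 0"
  shows "fps_nth (dilate k F) n = (if k dvd n then fps_nth F (n div k) else 0)"
proof -
  have "fps_nth (dilate k F) n = (\<Sum>i=0..n. if n = k * i then fps_nth F i else 0)"
    unfolding dilate_def fps_compose_nth power_mult[symmetric] by (rule sum.cong) auto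
  also have "\<dots> = (\<Sum>i\<in>{i\<in>{0..n}. n = k * i}. fps_nth F i)"
    by (rule sum.inter_filter[symmetric]) simp
  also have "{i\<in>{0..n}. n = k * i} = (if k dvd n then {n div k} else {})"
    using assms by auto
  finally show ?thesis by simp
qed

lemma gen_series_affine:
  assumes k: "k > 0" and nn: "\<And>x. x \<in> A \<Longrightarrow> e x \<ge> 0"
  shows "gen_series (\<lambda>x. int c + int k * e x) w A = fps_X ^ c * dilate k (gen_series e w A)"
proof (rule fps_ext)
  fix n
  show "fps_nth (gen_series (\<lambda>x. int c + int k * e x) w A) n =
      fps_nth (fps_X ^ c * dilate k (gen_series e w A)) n"
  proof (cases "c \<le> n \<and> k dvd n - c")
    case True
    then obtain m where n: "n = c + k * m" by (metis dvdE le_add_diff_inverse)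
    have "{x\<in>A. int c + int k * e x = int n} = {x\<in>A. e x = int m}"
      using k by (auto simp: n)
    then show ?thesis using k by (simp add: gen_series_def fps_X_power_mult_nth dilate_nth n)
  next
    case False
    have "{x\<in>A. int c + int k * e x = int n} = {}"
    proof safe
      fix x assume x: "x \<in> A" "int c + int k * e x = int n"
      then have "int n = int (c + k * nat (e x))" using nn by simp
      then have "n = c + k * nat (e x)" by linarith
      then show "x \<in> {}" using False by simp
    qed
    then have "fps_nth (gen_series (\<lambda>x. int c + int k * e x) w A) n = 0"
      by (simp only: gen_series_def fps_nth_Abs_fps sum.empty)
    then show ?thesis
      using False k by (auto simp: fps_X_power_mult_nth dilate_nth)
  qed
qed

lemma finite_theta_exp_fibre:
  assumes "i > 0"
  shows "finite {l. theta_exp i j l = int n}"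
proof (rule finite_subset)
  show "{l. theta_exp i j l = int n} \<subseteq> {- int n - 1..int n + 1}"
  proof
    fix l assume "l \<in> {l. theta_exp i j l = int n}"
    then show "l \<in> {- int n - 1..int n + 1}" using theta_exp_ge(1)[OF assms, of l j] by auto
  qed
qed simp

section \<open>The hexagonal form\<close>

lemma hexform_bound: "a * a \<le> 2 * hexform a b + 1" "(b + 1) * (b + 1) \<le> 2 * hexform a b + 1"
proof -
  have "2 * hexform a b + 1 = (a - b) * (a - b) + a * a + (b + 1) * (b + 1)"
    by (simp add: hexform_def algebra_simps)
  then show "a * a \<le> 2 * hexform a b + 1" "(b + 1) * (b + 1) \<le> 2 * hexform a b + 1" by auto
qed

lemma hexform_nonneg: "hexform a b \<ge> 0"
proof -
  have "a * a \<ge> 0" by simp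
  then show ?thesis using hexform_bound(1)[of a b] by linarith
qed

lemma abs_le_square: "\<bar>l\<bar> \<le> l * (l::int)"
  by (cases "l = 0") (use mult_left_mono[of 1 "\<bar>l\<bar>" "\<bar>l\<bar>"] in auto)

lemma finite_hexform_fibre: "finite {p\<in>A. case_prod hexform p = int n}"
proof (rule finite_subset)
  show "{p\<in>A. case_prod hexform p = int n} \<subseteq> {- 2 * int n - 2..2 * int n + 2} \<times> {- 2 * int n -
    2..2 * int n + 2}"
  proof safe
    fix a b assume "hexform a b = int n"
    then have "\<bar>a\<bar> \<le> 2 * int n + 1" "\<bar>b + 1\<bar> \<le> 2 * int n + 1"
      using order_trans[OF abs_le_square hexform_bound(1)[of a b]]
        order_trans[OF abs_le_square hexform_bound(2)[of b a]] by simp_all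
    then show "a \<in> {- 2 * int n - 2..2 * int n + 2}" "b \<in> {- 2 * int n - 2..2 * int n + 2}"
      by auto
  qed
qed simp

definition hex_series :: "(int \<times> int) set \<Rightarrow> rat fps" where
  "hex_series A = gen_series (case_prod hexform) (\<lambda>_. 1) A"

lemma hex_series_Un: "A \<inter> B = {} \<Longrightarrow> hex_series (A \<union> B) = hex_series A + hex_series B"
  unfolding hex_series_def by (rule gen_series_Un) (auto intro: finite_hexform_fibre)

text \<open>Multiplication by $\omega^2$ of the Eisenstein integer $1 - \sqrt{-3}\,(a + b\omega)$.\<close>

definition rot :: "int \<times> int \<Rightarrow> int \<times> int" where
  "rot = (\<lambda>(a, b). (b - a, - a - 1))"

lemma mem_rot_image: "(x, y) \<in> rot ` A \<longleftrightarrow> (- y - 1, x - y - 1) \<in> A"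
  by (force simp: rot_def image_iff)

lemma hex_series_rot: "hex_series (rot ` A) = hex_series A"
proof -
  have "inj_on rot A" by (auto simp: rot_def inj_on_def)
  then have "bij_betw rot A (rot ` A)" by (rule inj_on_imp_bij_betw)
  then show ?thesis unfolding hex_series_def
    by (rule gen_series_reindex[symmetric]) (auto simp: rot_def hexform_def algebra_simps)
qed

text \<open>Since \<open>rot\<close> preserves the form, the three images of a fundamental domain contribute
  equally.\<close>

lemma hex_series_fundamental_domain:
  assumes "D \<inter> rot ` D = {}" "D \<inter> rot ` rot ` D = {}"
    and "S = D \<union> rot ` D \<union> rot ` rot ` D"
  shows "hex_series S = 3 * hex_series D"
proof -
  have "rot ` D \<inter> rot ` rot ` D = rot ` (D \<inter> rot ` D)"
    by (rule image_Int[symmetric]) (auto simp: rot_def inj_on_def)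
  then have "(D \<union> rot ` D) \<inter> rot ` rot ` D = {}" using assms(1,2) by auto
  then show ?thesis unfolding assms(3)
    using assms(1) by (simp add: hex_series_Un hex_series_rot)
qed

lemma set_eq_pairI: "(\<And>x y. (x, y) \<in> A \<longleftrightarrow> (x, y) \<in> B) \<Longrightarrow> A = B" by auto

lemma disjoint_pairI: "(\<And>x y. (x, y) \<in> A \<Longrightarrow> (x, y) \<in> B \<Longrightarrow> False) \<Longrightarrow> A \<inter> B = {}"
  by auto

definition quadrant :: "(int \<times> int) set" where "quadrant = {(a, b). a \<ge> 0 \<and> b \<ge> 0}"

lemma even_hexform: "even (hexform a b) \<longleftrightarrow> even a \<or> odd b"
  by (auto simp: hexform_def)

text \<open>Both sets are fundamental domains of the whole plane: \<open>rot\<close> lowers $a + b$ by 1 modulo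
  3.\<close>

lemma hex_series_quadrant_mod_3: "hex_series quadrant = hex_series {(a, b). 3 dvd a + b}"
proof -
  have "hex_series UNIV = 3 * hex_series quadrant"
    by (intro hex_series_fundamental_domain disjoint_pairI set_eq_pairI)
      (simp_all add: quadrant_def mem_rot_image, linarith+)
  moreover have "hex_series UNIV = 3 * hex_series {(a, b). 3 dvd a + b}"
  proof (rule hex_series_fundamental_domain)
    show "{(a, b). 3 dvd a + b} \<inter> rot ` {(a::int, b). 3 dvd a + b} = {}"
      "{(a, b). 3 dvd a + b} \<inter> rot ` rot ` {(a::int, b). 3 dvd a + b} = {}"
      by (intro disjoint_pairI; simp add: mem_rot_image; presburger)+
    show "UNIV = {(a, b). 3 dvd a + b} \<union> rot ` {(a, b). 3 dvd a +
      b} \<union> rot ` rot ` {(a::int, b). 3 dvd a + b}"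
      by (rule set_eq_pairI) (simp add: mem_rot_image, presburger)
  qed
  ultimately show ?thesis by simp
qed

text \<open>The form is even on three of the four classes of $(a, b)$ modulo 2. These are permuted
  cyclically by \<open>rot\<close>, and two of them make up the points with odd \<open>b\<close>.\<close>

lemma hex_series_even:
  "2 * hex_series {(a, b). a \<ge> 0 \<and> b \<ge> 0 \<and> even (hexform a b)} = hex_series {(a, b). odd b}"
proof -
  define E where "E = {(a, b). even (hexform a b)}"
  define D where "D = {(a::int, b::int). even a \<and> even b}"
  have "hex_series E = 3 * hex_series {(a, b). a \<ge> 0 \<and> b \<ge> 0 \<and> even (hexform a b)}"
    by (intro hex_series_fundamental_domain disjoint_pairI set_eq_pairI;
        simp add: E_def mem_rot_image even_hexform; presburger)
  moreover have D: "D \<inter> rot ` D = {}" "D \<inter> rot ` rot ` D = {}"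
    by (intro disjoint_pairI; simp add: D_def mem_rot_image)+
  have "hex_series E = 3 * hex_series D"
    by (intro hex_series_fundamental_domain[OF D] set_eq_pairI;
      simp add: E_def D_def mem_rot_image even_hexform; argo)
  moreover have "{(a, b). odd b} = rot ` D \<union> rot ` rot ` D"
    by (rule set_eq_pairI) (simp add: D_def mem_rot_image, argo)
  moreover have "rot ` D \<inter> rot ` rot ` D = {}"
    by (rule disjoint_pairI) (simp add: D_def mem_rot_image)
  ultimately show ?thesis by (simp add: hex_series_Un hex_series_rot)
qed

text \<open>Completing the square separates the variables: $h(l + k, 2k - 1) = l(l+1) + k(3k-1)$.\<close>

lemma hex_series_odd_b:
  "hex_series {(a, b). odd b} = dilate 2 (theta 1 1 0 * theta 1 1 2)"
proof -
  have prod: "theta 1 1 0 * theta 1 1 2 = gen_series (\<lambda>(l, k). theta_exp 1 0 l +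
    theta_exp 1 2 k) (\<lambda>_. 1) (UNIV \<times> UNIV)"
    unfolding theta_def by (subst gen_series_mult) (auto
      simp: theta_exp_ge finite_theta_exp_fibre case_prod_unfold)
  have "dilate 2 (theta 1 1 0 * theta 1 1 2) = gen_series (\<lambda>p. int 0 +
    int 2 * (\<lambda>(l, k). theta_exp 1 0 l + theta_exp 1 2 k) p) (\<lambda>_. 1) (UNIV \<times> UNIV)"
    unfolding prod by (subst gen_series_affine) (auto simp: theta_exp_ge)
  also have "\<dots> = hex_series {(a, b). odd b}"
    unfolding hex_series_def
  proof (rule gen_series_reindex[of "\<lambda>(l, k). (l + k, 2 * k - 1)"])
    show "bij_betw (\<lambda>(l, k). (l + k, 2 * k - 1)) (UNIV \<times> UNIV) {(a::int, b::int). odd b}"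
      by (rule bij_betw_byWitness[where f' = "\<lambda>(a, b). (a - (b + 1) div 2, (b +
        1) div 2)"]) (auto elim!: oddE)
    fix p :: "int \<times> int"
    obtain l k where p: "p = (l, k)" by fastforce
    show "case_prod hexform ((\<lambda>(l, k). (l + k, 2 * k - 1)) p) =
        int 0 + int 2 * (\<lambda>(l, k). theta_exp 1 0 l + theta_exp 1 2 k) p"
      using two_tri[of l] two_tri[of k] two_tri[of "k - 1"]
      by (simp add: p hexform_def theta_exp_def algebra_simps)
  qed simp
  finally show ?thesis by simp
qed

text \<open>The form is odd iff \<open>a\<close> is odd and \<open>b\<close> is even, and there it reproduces itself: $h(2i +
  1, 2j) = 4\,h(j, i) + 1$.\<close>

lemma hex_series_odd:
  "hex_series {(a, b). a \<ge> 0 \<and> b \<ge> 0 \<and> odd (hexform a b)} = fps_X * dilate 4 (hex_series quadrant)"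
proof -
  have "fps_X ^ 1 * dilate 4 (hex_series quadrant) =
      gen_series (\<lambda>p. int 1 + int 4 * case_prod hexform p) (\<lambda>_. 1) quadrant"
    unfolding hex_series_def by (rule gen_series_affine[symmetric]) (auto simp: hexform_nonneg)
  also have "\<dots> = hex_series {(a, b). a \<ge> 0 \<and> b \<ge> 0 \<and> odd (hexform a b)}"
    unfolding hex_series_def
  proof (rule gen_series_reindex[of "\<lambda>(j, i). (2 * i + 1, 2 * j)"])
    show "bij_betw (\<lambda>(j, i). (2 * i + 1, 2 * j)) quadrant {(a, b). a \<ge> 0 \<and> b \<ge> 0 \<and>
      odd (hexform a b)}"
      by (rule bij_betw_byWitness[where f' = "\<lambda>(a, b). (b div 2, a div 2)"])
         (auto simp: quadrant_def even_hexform)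
  qed (auto simp: hexform_def algebra_simps)
  finally show ?thesis by simp
qed

section \<open>The 2-dissection of the series of 3-cores\<close>

definition cores_gf :: "rat fps" where
  "cores_gf = Abs_fps (\<lambda>n. of_nat (card {xs. is_core 3 xs \<and> sum_list xs = n}))"

lemma cores_gf_eq: "cores_gf = hex_series quadrant"
proof (rule fps_ext)
  fix n
  have "bij_betw (map_prod int int) {(a, b). hexform (int a) (int b) = int n}
      {p\<in>quadrant. case_prod hexform p = int n}"
    by (rule bij_betw_byWitness[where f' = "map_prod nat nat"]) (auto simp: quadrant_def)
  then show "fps_nth cores_gf n = fps_nth (hex_series quadrant) n"
    by (simp add: cores_gf_def hex_series_def gen_series_def card_3_cores bij_betw_same_card)
qed

theorem cores_gf_bisection:
  "2 * cores_gf = dilate 2 (theta 1 1 0 * theta 1 1 2) + 2 * fps_X * dilate 4 cores_gf"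
proof -
  have "quadrant = {(a, b). a \<ge> 0 \<and> b \<ge> 0 \<and> even (hexform a b)} \<union>
      {(a, b). a \<ge> 0 \<and> b \<ge> 0 \<and> odd (hexform a b)}" by (auto simp: quadrant_def)
  then have "hex_series quadrant = hex_series {(a, b). a \<ge> 0 \<and> b \<ge> 0 \<and> even (hexform a b)} +
      hex_series {(a, b). a \<ge> 0 \<and> b \<ge> 0 \<and> odd (hexform a b)}"
    using hex_series_Un[of "{(a, b). a \<ge> 0 \<and> b \<ge> 0 \<and> even (hexform a b)}"
        "{(a, b). a \<ge> 0 \<and> b \<ge> 0 \<and> odd (hexform a b)}"] by auto
  then have "2 * hex_series quadrant = 2 * hex_series {(a, b). a \<ge> 0 \<and> b \<ge> 0 \<and> even (hexform a b)} +
      2 * fps_X * dilate 4 (hex_series quadrant)"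
  proof -
    have "H = F + fps_X * G \<Longrightarrow> 2 * H = 2 * F + 2 * fps_X * G" for F G H :: "rat fps"
      by (simp add: algebra_simps)
    then show ?thesis using \<open>hex_series quadrant = _\<close> unfolding hex_series_odd by blast
  qed
  then show ?thesis
    unfolding cores_gf_eq hex_series_even hex_series_odd_b .
qed

section \<open>The product formula for the series of 3-cores\<close>

lemma qbinom_const_poly: "qbinom [:Q:] n k = [:qbinom Q n k:]"
  by (induction Q n k rule: qbinom.induct) (simp_all add: one_pCons poly_const_pow)

text \<open>The \<open>q\<close>-binomial theorem for $x = 1$ and with $yz$ in place of \<open>y\<close>, where \<open>z\<close> is a
  formal variable, so that coefficients of powers of \<open>z\<close> can be compared.\<close>

lemma q_binomial_poly:
  "(\<Prod>m<n. 1 + monom (y * Q ^ m) 1) = (\<Sum>k\<le>n. monom (Q ^ (\<Sum>{..<k}) * qbinom Q n k * y ^ k) k)"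
  for y Q :: "'a::comm_ring_1"
proof -
  have "(\<Prod>m<n. 1 + monom (y * Q ^ m) 1) = (\<Prod>m<n. 1 + monom y 1 * [:Q:] ^ m)"
    by (simp add: poly_const_pow mult.commute smult_monom)
  also have "\<dots> = (\<Sum>k\<le>n. monom (Q ^ (\<Sum>{..<k}) * qbinom Q n k * y ^ k) k)"
    unfolding q_binomial
    by (simp add: qbinom_const_poly poly_const_pow monom_power smult_monom mult_ac)
  finally show ?thesis .
qed

text \<open>The ways to choose $3n$ of the $6n$ factors $1 + z q^m$ when there are $2n$ factors in
  each residue class of $m$ modulo 3, recorded by the number of factors chosen in each class.\<close>

definition triples :: "nat \<Rightarrow> (nat \<times> nat \<times> nat) set" where
  "triples n = {(a, b, c). a \<le> 2 * n \<and> b \<le> 2 * n \<and> c \<le> 2 * n \<and> a + b + c = 3 * n}"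

text \<open>The size of a 3-core with charge vector $(-a-b, a, b)$ on the three runners of the
  abacus.\<close>

definition charge_form :: "int \<Rightarrow> int \<Rightarrow> int" where
  "charge_form a b = 3 * (a * a + a * b + b * b) + a + 2 * b"

lemma charge_form_ge: "2 * charge_form a b \<ge> \<bar>a\<bar> + \<bar>b\<bar> + \<bar>a + b\<bar>"
proof -
  define s where "s = a + b"
  have "2 * charge_form a b = 3 * (s * s) + 2 * s + 3 * (a * a) + 3 * (b * b) + 2 * b"
    by (simp add: charge_form_def s_def algebra_simps)
  moreover have "3 * (s * s) + 2 * s \<ge> \<bar>s\<bar>" "3 * (b * b) + 2 * b \<ge> \<bar>b\<bar>" "3 * (a * a) \<ge> \<bar>a\<bar>"
    using abs_le_square[of a] abs_le_square[of b] abs_le_square[of s] by linarith+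
  ultimately show ?thesis unfolding s_def by linarith
qed

lemma finite_triples [simp]: "finite (triples n)"
  by (rule finite_subset[of _ "{..2 * n} \<times> {..2 * n} \<times> {..2 * n}"]) (auto simp: triples_def)

text \<open>Compare coefficients of $z^{3n}$ in $\prod_{m<6n} (1 + z q^m)$, once by the \<open>q\<close>-binomial
  theorem for all factors and once by applying it to the three residue classes of $m$
  separately, where the base is $q^3$.\<close>

lemma qbinom_trisection:
  defines "Q \<equiv> (fps_X :: rat fps) ^ 3"
  shows "qbinom fps_X (6 * n) (3 * n) =
     (\<Sum>(a, b, c)\<in>triples n. qbinom Q (2 * n) a * qbinom Q (2 * n) b * qbinom Q (2 * n) c *
        fps_X ^ nat (charge_form (int b - int n) (int c - int n)))"
proof -
  \<comment> \<open>Both sides carry the common factor $q^{0 + 1 + \dots + (3n - 1)}$.\<close>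
  define d where "d = \<Sum>{..<3 * n}"
  define g where "g r k = Q ^ (\<Sum>{..<k}) * qbinom Q (2 * n) k * (fps_X ^ r) ^ k" for r k
  have split: "(\<Prod>m<6 * n. 1 + monom (1 * fps_X ^ m) 1) =
      (\<Prod>m<2 * n. 1 + monom (fps_X ^ 0 * Q ^ m) 1) *
      (\<Prod>m<2 * n. 1 + monom (fps_X ^ 1 * Q ^ m) 1) *
      (\<Prod>m<2 * n. 1 + monom (fps_X ^ 2 * Q ^ m) 1)"
    using prod_split_3[of "\<lambda>m. 1 + monom (1 * (fps_X :: rat fps) ^ m) 1" "2 * n"]
    by (simp add: Q_def power_add power2_eq_square mult_ac flip: power_mult)
  have "fps_X ^ d * qbinom fps_X (6 * n) (3 * n) =
      coeff (\<Prod>m<6 * n. 1 + monom (1 * (fps_X :: rat fps) ^ m) 1) (3 * n)"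
    unfolding q_binomial_poly by (simp add: coeff_sum d_def)
  also have "\<dots> = coeff (\<Sum>a\<le>2 * n. \<Sum>b\<le>2 * n. \<Sum>c\<le>2 * n. monom (g 0 a * g 1 b * g 2 c) (a + b +
    c)) (3 * n)"
    unfolding split
    unfolding q_binomial_poly g_def[symmetric] sum_product
    by (simp add: sum_distrib_left sum_distrib_right mult_monom)
       (rule arg_cong2[where f = coeff, OF sum.cong[OF refl sum.swap] refl])
  also have "\<dots> = (\<Sum>(a, b, c)\<in>{..2 * n} \<times> {..2 * n} \<times> {..2 * n}. if a + b + c =
    3 * n then g 0 a * g 1 b * g 2 c else 0)"
    by (simp add: coeff_sum sum.cartesian_product) (auto intro!: sum.cong)
  also have "\<dots> = (\<Sum>(a, b, c)\<in>triples n. g 0 a * g 1 b * g 2 c)"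
    by (rule sum.mono_neutral_cong_right) (auto simp: triples_def split: if_splits)
  also have "\<dots> = (\<Sum>(a, b, c)\<in>triples n. fps_X ^ d * (qbinom Q (2 * n) a * qbinom Q (2 * n) b *
    qbinom Q (2 * n) c *
        fps_X ^ nat (charge_form (int b - int n) (int c - int n))))"
  proof (intro sum.cong refl, clarify)
    fix a b c assume "(a, b, c) \<in> triples n"
    then have abc: "int a = 3 * int n - int b - int c" by (simp add: triples_def)
    have nn: "charge_form (int b - int n) (int c - int n) \<ge> 0"
      using charge_form_ge[of "int b - int n" "int c - int n"] by linarith
    have arith: "2 * (3 * sa + 3 * sb + b + (3 * sc + 2 * c)) =
      2 * (sd + charge_form (b - n) (c - n))"
      if "2 * sa = a * (a - 1)" "2 * sb = b * (b - 1)" "2 * sc = c * (c - 1)"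
        "2 * sd = (3 * n) * (3 * n - 1)" "a = 3 * n - b - c" for sa sb sc sd a b c n :: int
    proof -
      have "2 * (3 * sa + 3 * sb + b + (3 * sc + 2 * c)) =
          3 * (2 * sa) + 3 * (2 * sb) + 2 * b + 3 * (2 * sc) + 4 * c" by simp
      then show ?thesis unfolding that distrib_left[of 2 sd] by
        (simp add: charge_form_def algebra_simps)
    qed
    have eq: "2 * int (3 * \<Sum>{..<a} + 3 * \<Sum>{..<b} + b + (3 * \<Sum>{..<c} + 2 * c)) =
        2 * (int d + charge_form (int b - int n) (int c - int n))"
      using arith[OF two_sum_lessThan[of a] two_sum_lessThan[of b] two_sum_lessThan[of c], of
        "int d" "int n"] two_sum_lessThan[of "3 * n"] abc
      unfolding d_def by (simp only: of_nat_add of_nat_mult of_nat_numeral simp_thms)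
    have ex: "3 * \<Sum>{..<a} + 3 * \<Sum>{..<b} + b + (3 * \<Sum>{..<c} + 2 * c) =
        d + nat (charge_form (int b - int n) (int c - int n))"
      by (rule half_int_eq[OF eq nn])
    have "g 0 a * g 1 b * g 2 c = qbinom Q (2 * n) a * qbinom Q (2 * n) b * qbinom Q (2 * n) c *
        fps_X ^ (3 * \<Sum>{..<a} + 3 * \<Sum>{..<b} + b + (3 * \<Sum>{..<c} + 2 * c))"
    proof -
      have "(fps_X ^ 0) ^ a = (1 :: rat fps)" "(fps_X ^ 1) ^ b = (fps_X :: rat fps) ^ b"
        "(fps_X ^ 2) ^ c = (fps_X :: rat fps) ^ (2 * c)" by (simp_all add: power_mult)
      moreover have "Q ^ k = fps_X ^ (3 * k)" for k by (simp add: Q_def power_mult)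
      ultimately show ?thesis by (simp only: g_def power_add mult_1_left mult_1_right mult_ac)
    qed
    then show "g 0 a * g 1 b * g 2 c = fps_X ^ d * (qbinom Q (2 * n) a * qbinom Q (2 * n) b *
      qbinom Q (2 * n) c *
        fps_X ^ nat (charge_form (int b - int n) (int c - int n)))"
      unfolding ex by (simp only: power_add mult_ac)
  qed
  also have "\<dots> = fps_X ^ d * (\<Sum>(a, b, c)\<in>triples n. qbinom Q (2 * n) a * qbinom Q (2 * n) b *
    qbinom Q (2 * n) c *
        fps_X ^ nat (charge_form (int b - int n) (int c - int n)))"
    by (simp add: sum_distrib_left case_prod_unfold)
  finally show ?thesis by simp
qed

text \<open>The limit of \<open>qbinom_trisection\<close>: on the left the binomial coefficient tends to $1/f_1$,
  and each of the three on the right to $1/f_3$.\<close>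

theorem charge_form_series_times_f:
  "gen_series (case_prod charge_form) (\<lambda>_. 1) UNIV * f 1 = f 3 ^ 3"
proof (rule agree_imp_eq)
  fix M :: nat
  \<comment> \<open>A term with some index further than $2M$ from the centre \<open>n\<close> has exponent at least \<open>M\<close>;
    for the others each lower index and its complement in $2n$ are at least $n - 2M = M$.\<close>
  define n where "n = 3 * M"
  define Q where "Q = (fps_X :: rat fps) ^ 3"
  define T where "T b c = (fps_X :: rat fps) ^ nat (charge_form (int b - int n) (int c -
    int n))" for b c
  have "agree M (\<Sum>(a, b, c)\<in>triples n. (qbinom Q (2 * n) a * f 3) * (qbinom Q (2 * n) b * f 3) *
      (qbinom Q (2 * n) c * f 3) * T b c) (\<Sum>(a, b, c)\<in>triples n. 1 * 1 * 1 * T b c)"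
  proof (rule agree_sum, clarify)
    fix a b c assume "(a, b, c) \<in> triples n"
    then have abc: "a + b + c = 3 * n" by (simp add: triples_def)
    show "agree M ((qbinom Q (2 * n) a * f 3) * (qbinom Q (2 * n) b * f 3) *
      (qbinom Q (2 * n) c * f 3) * T b c) (1 * 1 * 1 * T b c)"
    proof (cases "\<bar>int a - int n\<bar> \<le> 2 * int M \<and> \<bar>int b - int n\<bar> \<le> 2 * int M \<and> \<bar>int c -
      int n\<bar> \<le> 2 * int M")
      case True
      then have "M \<le> a" "M + a \<le> 2 * n" "M \<le> b" "M + b \<le> 2 * n" "M \<le> c" "M + c \<le> 2 * n"
        by (auto simp: n_def)
      then show ?thesis unfolding Q_def by (intro agree_mult agree_qbinom agree_refl) auto
    next
      case False
      have "int a - int n = - ((int b - int n) + (int c - int n))" using abc by linarith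
      then have "M \<le> nat (charge_form (int b - int n) (int c - int n))"
        using charge_form_ge[of "int b - int n" "int c - int n"] False by linarith
      then have "agree M (F * T b c) 0" for F unfolding T_def by (rule agree_X_power)
      then show ?thesis by (blast intro: agree_trans agree_sym)
    qed
  qed
  also have "(\<Sum>(a, b, c)\<in>triples n. 1 * 1 * 1 * T b c) =
    (\<Sum>p\<in>{(x, y). \<bar>x\<bar> \<le> int n \<and> \<bar>y\<bar> \<le> int n \<and> \<bar>x + y\<bar> \<le> int n}.
      fps_const 1 * fps_X ^ nat (case_prod charge_form p))"
    by (rule sum.reindex_bij_witness[of _ "\<lambda>(x, y). (nat (int n - x - y), nat (x +
      int n), nat (y + int n))"
        "\<lambda>(a, b, c). (int b - int n, int c - int n)"]) (auto simp: triples_def T_def)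
  also have "agree M \<dots> (gen_series (case_prod charge_form) (\<lambda>_. 1) UNIV)"
  proof (rule agree_gen_series)
    show "finite {(x, y). \<bar>x\<bar> \<le> int n \<and> \<bar>y\<bar> \<le> int n \<and> \<bar>x + y\<bar> \<le> int n}"
      by (rule finite_subset[of _ "{- int n..int n} \<times> {- int n..int n}"]) auto
    fix p :: "int \<times> int"
    obtain x y where p: "p = (x, y)" by fastforce
    show "0 \<le> case_prod charge_form p" using charge_form_ge[of x y] by (simp add: p)
    show "int M \<le> case_prod charge_form p"
      if "p \<in> UNIV - {(x, y). \<bar>x\<bar> \<le> int n \<and> \<bar>y\<bar> \<le> int n \<and> \<bar>x + y\<bar> \<le> int n}"
      using that charge_form_ge[of x y] by (auto simp: p n_def)
  qed simp
  finally have "agree M (\<Sum>(a, b, c)\<in>triples n. (qbinom Q (2 * n) a * f 3) * (qbinom Q (2 * n) b *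
    f 3) *
      (qbinom Q (2 * n) c * f 3) * T b c) (gen_series (case_prod charge_form) (\<lambda>_. 1) UNIV)" .
  moreover have "(\<Sum>(a, b, c)\<in>triples n. (qbinom Q (2 * n) a * f 3) * (qbinom Q (2 * n) b * f 3) *
      (qbinom Q (2 * n) c * f 3) * T b c) = f 3 ^ 3 * qbinom fps_X (6 * n) (3 * n)"
    unfolding qbinom_trisection Q_def T_def sum_distrib_left
    by (rule sum.cong) (auto simp: power3_eq_cube mult_ac)
  ultimately have "agree M (gen_series (case_prod charge_form) (\<lambda>_. 1) UNIV) (f 3 ^ 3 *
    qbinom fps_X (6 * n) (3 * n))"
    by (simp add: agree_sym)
  then have "agree M (gen_series (case_prod charge_form) (\<lambda>_. 1) UNIV * f 1) (f 3 ^ 3 *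
    qbinom fps_X (6 * n) (3 * n) * f 1)"
    by (rule agree_mult) simp
  also have "f 3 ^ 3 * qbinom fps_X (6 * n) (3 * n) * f 1 =
    f 3 ^ 3 * (qbinom (fps_X ^ 1) (6 * n) (3 * n) * f 1)"
    by (simp add: mult.assoc)
  also have "agree M \<dots> (f 3 ^ 3 * 1)"
    by (intro agree_mult agree_refl agree_qbinom) (auto simp: n_def)
  finally show "agree M (gen_series (case_prod charge_form) (\<lambda>_. 1) UNIV * f 1) (f 3 ^ 3)" by simp
qed

text \<open>The substitution $(x, y) \mapsto (y - x, 2y + x)$ maps the plane onto the fundamental
  domain $3 \mid a + b$ and turns \<open>hexform\<close> into \<open>charge_form\<close>.\<close>

theorem cores_gf_product: "cores_gf * f 1 = f 3 ^ 3"
proof -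
  have "gen_series (case_prod charge_form) (\<lambda>_. 1) UNIV = hex_series {(a, b). 3 dvd a + b}"
    unfolding hex_series_def
  proof (rule gen_series_reindex[of "\<lambda>(x, y). (y - x, 2 * y + x)"])
    show "bij_betw (\<lambda>(x, y). (y - x, 2 * y + x)) UNIV {(a::int, b). 3 dvd a + b}"
      by (rule bij_betw_byWitness[where f' = "\<lambda>(a, b). ((a + b) div 3 - a, (a + b) div 3)"])
         (auto elim!: dvdE)
  qed (auto simp: hexform_def charge_form_def algebra_simps)
  then show ?thesis
    using charge_form_series_times_f by (simp add: cores_gf_eq hex_series_quadrant_mod_3)
qed

section \<open>Trisection and the cubic norm\<close>

lemma dilate_ring [simp]:
  assumes "k > 0"
  shows "dilate k (F + G) = dilate k F + dilate k G" "dilate k (F - G) = dilate k F - dilate k G"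
    "dilate k (F * G) = dilate k F * dilate k G" "dilate k (F ^ n) = dilate k F ^ n"
    "dilate k fps_X = fps_X ^ k" "dilate k (numeral m) = numeral m" "dilate k 1 =
      1" "dilate k 0 = 0"
    "dilate k (- F) = - dilate k F"
proof -
  have z: "fps_nth ((fps_X :: rat fps) ^ k) 0 = 0" using assms by simp
  show "dilate k (F + G) = dilate k F + dilate k G" "dilate k (F - G) = dilate k F - dilate k G"
    "dilate k (- F) = - dilate k F"
    by (simp_all add: dilate_def fps_compose_add_distrib fps_compose_sub_distrib fps_compose_uminus)
  show "dilate k (F * G) = dilate k F * dilate k G" "dilate k (F ^ n) = dilate k F ^ n"
    by (simp_all add: dilate_def fps_compose_mult_distrib[OF z] fps_compose_power[OF z])
  show "dilate k fps_X = fps_X ^ k" using z by (simp add: dilate_def)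
  show "dilate k (numeral m) = numeral m" "dilate k 1 = 1" "dilate k 0 = 0"
    by (simp_all add: dilate_def numeral_fps_const)
qed

lemma dilate_dilate:
  assumes "k > 0" "l > 0"
  shows "dilate k (dilate l F) = dilate (k * l) F"
proof -
  have "F oo (fps_X ^ l oo fps_X ^ k) = F oo fps_X ^ l oo fps_X ^ k"
    using assms by (intro fps_compose_assoc) auto
  moreover have "(fps_X :: rat fps) ^ l oo fps_X ^ k = fps_X ^ (k * l)"
    using dilate_ring(4,5)[OF assms(1)] by (simp add: dilate_def power_mult)
  ultimately show ?thesis by (simp add: dilate_def)
qed

lemma dilate_prod: "k > 0 \<Longrightarrow> dilate k (prod F A) = (\<Prod>x\<in>A. dilate k (F x))"
  by (induction A rule: infinite_finite_induct) auto

lemma agree_dilate: "agree M F G \<Longrightarrow> k > 0 \<Longrightarrow> agree M (dilate k F) (dilate k G)"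
  unfolding agree_def by (metis dilate_nth div_le_dividend le_less_trans)

lemma agree_f: "k > 0 \<Longrightarrow> agree n (\<Prod>m<n. 1 - fps_const 1 * fps_X ^ (k + m * k)) (f k)"
  by (simp only: f_eq_qprod agree_qprod_self)

lemma dilate_f:
  assumes "k > 0" "n > 0"
  shows "dilate k (f n) = f (k * n)"
proof (rule agree_imp_eq)
  fix M
  have "agree M (dilate k (f n)) (dilate k (\<Prod>m<M. 1 - fps_const 1 * fps_X ^ (n + m * n)))"
    by (intro agree_dilate agree_sym[OF agree_f] assms)
  also have "dilate k (\<Prod>m<M. 1 - fps_const 1 * fps_X ^ (n + m * n)) =
      (\<Prod>m<M. 1 - fps_const 1 * fps_X ^ (k * n + m * (k * n)))"
    using assms by (simp add: dilate_prod algebra_simps flip: power_mult)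
  also have "agree M \<dots> (f (k * n))"
    using assms by (intro agree_f) simp
  finally show "agree M (dilate k (f n)) (f (k * n))" .
qed

text \<open>The terms with exponent \<open>r\<close> modulo 3, with $q^{3n+r}$ replaced by $q^n$.\<close>

definition part3 :: "nat \<Rightarrow> rat fps \<Rightarrow> rat fps" where
  "part3 r F = Abs_fps (\<lambda>n. fps_nth F (3 * n + r))"

lemma part3_trisect:
  assumes "F = dilate 3 A + fps_X * dilate 3 B + fps_X ^ 2 * dilate 3 C"
  shows "part3 0 F = A" "part3 (Suc 0) F = B" "part3 2 F = C"
proof -
  have "fps_nth F (3 * n) = fps_nth A n" for n
  proof -
    have "n = 0 \<or> \<not> 3 dvd 3 * n - 1 \<and> \<not> 3 dvd 3 * n - 2" by presburger
    then show ?thesis by (auto simp: assms fps_X_power_mult_nth dilate_nth)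
  qed
  moreover have "fps_nth F (3 * n + Suc 0) = fps_nth B n" for n
  proof -
    have "n = 0 \<or> \<not> 3 dvd 3 * n + 1 - 2" "\<not> 3 dvd 3 * n + 1" by presburger+
    then show ?thesis by (auto simp: assms fps_X_power_mult_nth dilate_nth)
  qed
  moreover have "fps_nth F (3 * n + 2) = fps_nth C n" for n
  proof -
    have "\<not> 3 dvd 3 * n + 2" "\<not> 3 dvd 3 * n + 1" by presburger+
    then show ?thesis by (auto simp: assms fps_X_power_mult_nth dilate_nth)
  qed
  ultimately show "part3 0 F = A" "part3 (Suc 0) F = B" "part3 2 F = C"
    by (simp_all only: fps_eq_iff part3_def fps_nth_Abs_fps add_0_right simp_thms)
qed

lemma trisect:
  "F = dilate 3 (part3 0 F) + fps_X * dilate 3 (part3 (Suc 0) F) + fps_X ^ 2 * dilate 3 (part3 2 F)"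
proof (rule fps_ext)
  fix n :: nat
  show "fps_nth F n = fps_nth (dilate 3 (part3 0 F) + fps_X * dilate 3 (part3 (Suc 0) F) +
    fps_X ^ 2 * dilate 3 (part3 2 F)) n"
  proof (cases n rule: residue_cases_3)
    case (1 i)
    have "i = 0 \<or> \<not> 3 dvd 3 * i - 1 \<and> \<not> 3 dvd 3 * i - 2" by presburger
    with 1 show ?thesis by (auto simp: part3_def fps_X_power_mult_nth dilate_nth)
  next
    case (2 i)
    have "i = 0 \<or> \<not> 3 dvd 3 * i + 1 - 2" "\<not> 3 dvd 3 * i + 1" by presburger+
    with 2 show ?thesis by (auto simp: part3_def fps_X_power_mult_nth dilate_nth)
  next
    case (3 i)
    have "\<not> 3 dvd 3 * i + 2" "\<not> 3 dvd 3 * i + 1" by presburger+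
    with 3 show ?thesis by (auto simp: part3_def fps_X_power_mult_nth dilate_nth)
  qed
qed

lemma part3_mult:
  "part3 0 (F * G) = part3 0 F * part3 0 G + fps_X * (part3 (Suc 0) F * part3 2 G +
    part3 2 F * part3 (Suc 0) G)"
  "part3 (Suc 0) (F * G) = part3 0 F * part3 (Suc 0) G + part3 (Suc 0) F * part3 0 G +
    fps_X * (part3 2 F * part3 2 G)"
  "part3 2 (F * G) = part3 0 F * part3 2 G + part3 (Suc 0) F * part3 (Suc 0) G +
    part3 2 F * part3 0 G"
proof -
  define a0 a1 a2 b0 b1 b2 where ab: "a0 = part3 0 F" "a1 = part3 (Suc 0) F" "a2 = part3 2 F"
    "b0 = part3 0 G" "b1 = part3 (Suc 0) G" "b2 = part3 2 G"
  have "F * G = (dilate 3 a0 + fps_X * dilate 3 a1 + fps_X ^ 2 * dilate 3 a2) *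
      (dilate 3 b0 + fps_X * dilate 3 b1 + fps_X ^ 2 * dilate 3 b2)"
    unfolding ab by (simp only: trisect[symmetric])
  also have "\<dots> = dilate 3 (a0 * b0 + fps_X * (a1 * b2 + a2 * b1)) +
      fps_X * dilate 3 (a0 * b1 + a1 * b0 + fps_X * (a2 * b2)) +
      fps_X ^ 2 * dilate 3 (a0 * b2 + a1 * b1 + a2 * b0)"
    by (simp add: algebra_simps power2_eq_square power3_eq_cube)
  finally have eq: "F * G = \<dots>" .
  show "part3 0 (F * G) = part3 0 F * part3 0 G + fps_X * (part3 (Suc 0) F * part3 2 G +
    part3 2 F * part3 (Suc 0) G)"
    "part3 (Suc 0) (F * G) = part3 0 F * part3 (Suc 0) G + part3 (Suc 0) F * part3 0 G +
      fps_X * (part3 2 F * part3 2 G)"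
    "part3 2 (F * G) = part3 0 F * part3 2 G + part3 (Suc 0) F * part3 (Suc 0) G +
      part3 2 F * part3 0 G"
    using part3_trisect[OF eq] by (simp_all only: ab)
qed

lemma part3_dilate [simp]: "part3 0 (dilate 3 F) = F" "part3 (Suc 0) (dilate 3 F) =
  0" "part3 2 (dilate 3 F) = 0"
  using part3_trisect[of "dilate 3 F" F 0 0] by auto

lemma part3_X [simp]: "part3 0 fps_X = 0" "part3 (Suc 0) fps_X = 1" "part3 2 fps_X = 0"
  using part3_trisect[of fps_X 0 1 0] by auto

lemma part3_add [simp]: "part3 r (F + G) = part3 r F + part3 r G"
  by (simp add: part3_def fps_eq_iff)

lemma part3_dilate_mult [simp]: "part3 0 (dilate 3 F * G) = F * part3 0 G"
  "part3 (Suc 0) (dilate 3 F * G) = F * part3 (Suc 0) G" "part3 2 (dilate 3 F * G) = F * part3 2 G"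
  by (simp_all add: part3_mult)

text \<open>The norm of $F = F_0(q^3) + q F_1(q^3) + q^2 F_2(q^3)$ as an element of a cubic
  extension of the power series in $q^3$, with $q^3$ renamed to $q$. Over the complex numbers it
  is the product $F(q) F(\omega q) F(\omega^2 q)$; the formula below is that product expanded
  and avoids cube roots of unity.\<close>

definition norm3 :: "rat fps \<Rightarrow> rat fps" where
  "norm3 F = part3 0 F ^ 3 + fps_X * part3 (Suc 0) F ^ 3 + fps_X ^ 2 * part3 2 F ^ 3
     - 3 * fps_X * (part3 0 F * part3 (Suc 0) F * part3 2 F)"

lemma norm3_mult: "norm3 (F * G) = norm3 F * norm3 G"
proof -
  have "(a0 * b0 + q * (a1 * b2 + a2 * b1)) ^ 3 + q * (a0 * b1 + a1 * b0 + q * (a2 * b2)) ^ 3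
      + q ^ 2 * (a0 * b2 + a1 * b1 + a2 * b0) ^ 3
      - 3 * q * ((a0 * b0 + q * (a1 * b2 + a2 * b1)) * (a0 * b1 + a1 * b0 +
        q * (a2 * b2)) * (a0 * b2 + a1 * b1 + a2 * b0))
      = (a0 ^ 3 + q * a1 ^ 3 + q ^ 2 * a2 ^ 3 - 3 * q * (a0 * a1 * a2)) *
        (b0 ^ 3 + q * b1 ^ 3 + q ^ 2 * b2 ^ 3 - 3 * q * (b0 * b1 * b2))"
    for a0 a1 a2 b0 b1 b2 q :: "rat fps"
    by algebra
  then show ?thesis unfolding norm3_def part3_mult .
qed

lemma norm3_1 [simp]: "norm3 1 = 1"
  using part3_dilate[of 1] by (simp add: norm3_def)

lemma norm3_power: "norm3 (F ^ n) = norm3 F ^ n"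
  by (induction n) (auto simp: norm3_mult)

lemma norm3_prod: "norm3 (prod F A) = (\<Prod>x\<in>A. norm3 (F x))"
  by (induction A rule: infinite_finite_induct) (auto simp: norm3_mult)

lemma agree_part3: "agree (3 * M) F G \<Longrightarrow> r < 3 \<Longrightarrow> agree M (part3 r F) (part3 r G)"
  by (auto simp: agree_def part3_def)

lemma agree_uminus: "agree M F G \<Longrightarrow> agree M (- F) (- G)"
  by (simp add: agree_def)

lemma agree_power: "agree M F G \<Longrightarrow> agree M (F ^ n) (G ^ n)"
  by (induction n) (auto intro: agree_mult)

lemma agree_norm3:
  assumes "agree (3 * M) F G"
  shows "agree M (norm3 F) (norm3 G)"
  unfolding norm3_def diff_conv_add_uminus
  by (intro agree_add agree_uminus agree_mult agree_power agree_refl agree_part3 assms) auto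

lemma norm3_one_minus_X_power:
  "norm3 (1 - fps_X ^ (3 * m)) = (1 - fps_X ^ m) ^ 3"
  "\<not> 3 dvd k \<Longrightarrow> norm3 (1 - fps_X ^ k) = 1 - fps_X ^ k"
proof -
  have eq: "1 - fps_X ^ (3 * m) = dilate 3 (1 - fps_X ^ m)"
    by (simp add: power_mult)
  show "norm3 (1 - fps_X ^ (3 * m)) = (1 - fps_X ^ m) ^ 3"
    unfolding eq norm3_def part3_dilate by simp
  assume "\<not> 3 dvd k"
  then consider t where "k = 3 * t + 1" | t where "k = 3 * t + 2"
    by (cases k rule: residue_cases_3) auto
  then show "norm3 (1 - fps_X ^ k) = 1 - fps_X ^ k"
  proof cases
    case (1 t)
    then have "1 - fps_X ^ k = dilate 3 1 + fps_X * dilate 3 (- (fps_X ^ t)) +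
      fps_X ^ 2 * dilate 3 0"
      by (simp add: power_mult)
    note p = part3_trisect[OF this]
    show ?thesis unfolding norm3_def p by (simp add: 1 power_mult mult.commute)
  next
    case (2 t)
    then have "1 - fps_X ^ k = dilate 3 1 + fps_X * dilate 3 0 +
      fps_X ^ 2 * dilate 3 (- (fps_X ^ t))"
      by (simp add: power_mult power2_eq_square)
    note p = part3_trisect[OF this]
    show ?thesis unfolding norm3_def p
      by (simp add: 2 power_mult mult.commute power2_eq_square)
  qed
qed

text \<open>The norm of $1 - q^m$ is $1 - q^m$ if 3 does not divide $m$, and $(1 - q^{m/3})^3$
  otherwise.\<close>

theorem norm3_f:
  assumes k: "\<not> 3 dvd k"
  shows "norm3 (f k) * f (3 * k) = f k ^ 4"
proof (rule agree_imp_eq)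
  fix M
  have k0: "k > 0" using k by (cases k) auto
  define P where "P n l = (\<Prod>m<n. 1 - fps_const 1 * (fps_X :: rat fps) ^ (l + m * l))" for n l
  have P: "agree n (P n l) (f l)" if "l > 0" for n l
    unfolding P_def using that by (rule agree_f)
  have "norm3 (P (3 * M) k) * P M (3 * k) = P (3 * M) k * P M k ^ 3"
  proof -
    have 1: "norm3 (1 - fps_X ^ (k + 3 * m * k)) = 1 - fps_X ^ (k + 3 * m * k)"
      "norm3 (1 - fps_X ^ (k + (3 * m + 1) * k)) = 1 - fps_X ^ (k + (3 * m + 1) * k)"
      "norm3 (1 - fps_X ^ (k + (3 * m + 2) * k)) = (1 - fps_X ^ (k + m * k)) ^ 3"
      "k + (3 * m + 2) * k = 3 * k + m * (3 * k)" for m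
    proof -
      have "k + 3 * m * k = 3 * (m * k) + k" "k + (3 * m + 1) * k = 3 * (m * k) + 2 * k" by auto
      moreover have "\<not> 3 dvd 3 * (m * k) + k" "\<not> 3 dvd 3 * (m * k) + 2 * k" using k by presburger+
      ultimately show "norm3 (1 - fps_X ^ (k + 3 * m * k)) = 1 - fps_X ^ (k + 3 * m * k)"
        "norm3 (1 - fps_X ^ (k + (3 * m + 1) * k)) = 1 - fps_X ^ (k + (3 * m + 1) * k)"
        by (simp_all only: norm3_one_minus_X_power not_False_eq_True)
      have "k + (3 * m + 2) * k = 3 * (k + m * k)" by (simp add: algebra_simps)
      then show "norm3 (1 - fps_X ^ (k + (3 * m + 2) * k)) = (1 - fps_X ^ (k + m * k)) ^ 3"
        by (simp only: norm3_one_minus_X_power)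
      show "k + (3 * m + 2) * k = 3 * k + m * (3 * k)" by (simp add: algebra_simps)
    qed
    show ?thesis
      unfolding P_def prod_split_3 norm3_mult norm3_prod fps_const_1_eq_1 mult_1_left 1(1-3)
      unfolding 1(4) by (simp only: prod_power_distrib mult_ac)
  qed
  moreover have "agree M (norm3 (f k) * f (3 * k)) (norm3 (P (3 * M) k) * P M (3 * k))"
    using k0 by (intro agree_mult agree_norm3 agree_sym[OF P]) auto
  moreover have "agree (3 * M) (P (3 * M) k) (f k)" using P[OF k0] .
  then have "agree M (P (3 * M) k) (f k)" by (simp add: agree_def)
  then have "agree M (P (3 * M) k * P M k ^ 3) (f k * f k ^ 3)"
    using P[OF k0] by (intro agree_mult agree_power)
  ultimately show "agree M (norm3 (f k) * f (3 * k)) (f k ^ 4)"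
    using agree_trans by (metis power_Suc numeral_eq_Suc pred_numeral_simps(2) semiring_norm(26,27))
qed

section \<open>Products and trisections of the theta series\<close>

text \<open>In each case the triple product is multiplied by factors that complete its progressions
  of exponents, either to all multiples of some $k$, or through $(1 - q^m)(1 + q^m) = 1 -
  q^{2m}$.\<close>

lemma theta_eta_quotients:
  "theta 1 1 0 * f 1 = 2 * f 2 ^ 2"
  "theta 1 1 2 * f 1 * f 6 = f 2 * f 3 ^ 2"
  "theta (-1) 1 1 * f 2 = f 1 ^ 2"
  "theta (-1) 1 5 * f 2 * f 3 = f 1 * f 6 ^ 2"
proof -
  have f: "f 1 = qprod 1 1 1" "f 2 = qprod 1 2 2" "f 3 = qprod 1 3 3" "f 6 = qprod 1 6 6"
    by (simp_all add: f_eq_qprod)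
  have "theta 1 1 0 = qprod (-1) 1 1 * (2 * qprod (-1) 1 1) * f 1"
    using jacobi_triple[of 1 1 0] by (simp add: qprod_0 numeral_fps_const)
  then have "theta 1 1 0 * f 1 = 2 * (qprod (-1) 1 1 * qprod 1 1 1) ^ 2"
    by (simp only: f power2_eq_square mult_ac)
  also have "qprod (-1) 1 1 * qprod 1 1 1 = f 2"
    by (subst qprod_mult_neg) (simp_all add: f)
  finally show "theta 1 1 0 * f 1 = 2 * f 2 ^ 2" .
  have J: "theta 1 1 2 = qprod (-1) 1 3 * qprod (-1) 2 3 * f 3"
    using jacobi_triple[of 1 1 2] by (simp del: One_nat_def)
  have f1: "f 1 = qprod 1 1 3 * qprod 1 2 3 * f 3"
    using qprod_split_3[of 1 1 1] by (simp add: f del: One_nat_def)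
  have f2: "f 2 = qprod 1 2 6 * qprod 1 4 6 * f 6"
    using qprod_split_3[of 2 1 2] by (simp add: f)
  have "theta 1 1 2 * f 1 * f 6 =
      (qprod (-1) 1 3 * qprod 1 1 3) * (qprod (-1) 2 3 * qprod 1 2 3) * f 6 * f 3 ^ 2"
    unfolding J f1 by (simp only: power2_eq_square mult_ac)
  also have "\<dots> = f 2 * f 3 ^ 2"
    unfolding f2 by (simp add: qprod_mult_neg del: One_nat_def)
  finally show "theta 1 1 2 * f 1 * f 6 = f 2 * f 3 ^ 2" .
  have "theta (-1) 1 1 = qprod 1 1 2 * qprod 1 1 2 * f 2"
    using jacobi_triple[of "-1" 1 1] by (simp del: One_nat_def)
  moreover have f1': "f 1 = qprod 1 1 2 * f 2"
    using qprod_split_2[of 1 1 1] by (simp add: f del: One_nat_def)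
  ultimately show "theta (-1) 1 1 * f 2 = f 1 ^ 2"
    by (simp only: power2_eq_square mult_ac)
  have "qprod 1 1 2 = qprod 1 1 6 * qprod 1 3 6 * qprod 1 5 6"
    using qprod_split_3[of 2 1 1] by (simp del: One_nat_def)
  then have "f 1 = qprod 1 1 6 * qprod 1 3 6 * qprod 1 5 6 * f 2"
    unfolding f1' by (simp only:)
  moreover have "f 3 = qprod 1 3 6 * f 6"
    using qprod_split_2[of 3 1 3] by (simp add: f)
  moreover have "theta (-1) 1 5 = qprod 1 1 6 * qprod 1 5 6 * f 6"
    using jacobi_triple[of "-1" 1 5] by (simp del: One_nat_def)
  ultimately show "theta (-1) 1 5 * f 2 * f 3 = f 1 * f 6 ^ 2"
    by (simp only: power2_eq_square mult_ac)
qed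

lemma gen_series_residues_3:
  fixes e :: "int \<Rightarrow> int"
  assumes fin: "\<And>n. finite {l. e l = int n}"
    and h: "bij_betw h0 UNIV {l. l mod 3 = 0}" "bij_betw h1 UNIV {l. l mod 3 = 1}"
      "bij_betw h2 UNIV {l. l mod 3 = 2}"
  shows "gen_series e w UNIV = gen_series (\<lambda>l. e (h0 l)) (\<lambda>l. w (h0 l)) (UNIV :: int set) +
     gen_series (\<lambda>l. e (h1 l)) (\<lambda>l. w (h1 l)) (UNIV :: int set) +
       gen_series (\<lambda>l. e (h2 l)) (\<lambda>l. w (h2 l)) (UNIV :: int set)"
proof -
  have fin': "finite {l\<in>A. e l = int n}" for A n by (rule finite_subset[OF _ fin]) auto
  then have U: "gen_series e w (A \<union> B) = gen_series e w A + gen_series e w B" if "A \<inter> B =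
    {}" for A B
    using that by (intro gen_series_Un)
  have "gen_series e w ({l. l mod 3 = 0} \<union> {l. l mod 3 = 1} \<union> {l. l mod 3 = 2}) =
      gen_series e w {l. l mod 3 = 0} + gen_series e w {l. l mod 3 =
        1} + gen_series e w {l. l mod 3 = 2}"
    by (subst U, force, subst U, force, rule refl)
  moreover have "{l. l mod 3 = 0} \<union> {l. l mod 3 = 1} \<union> {l. l mod 3 = 2} = (UNIV :: int set)"
    by (rule set_eqI) (simp, presburger)
  moreover have "gen_series e w {l. l mod 3 = 0} = gen_series (\<lambda>l. e (h0 l)) (\<lambda>l. w (h0 l)) UNIV"
    "gen_series e w {l. l mod 3 = 1} = gen_series (\<lambda>l. e (h1 l)) (\<lambda>l. w (h1 l)) UNIV"
    "gen_series e w {l. l mod 3 = 2} = gen_series (\<lambda>l. e (h2 l)) (\<lambda>l. w (h2 l)) UNIV"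
    by (rule gen_series_reindex[symmetric, OF h(1)] gen_series_reindex[symmetric, OF h(2)]
      gen_series_reindex[symmetric, OF h(3)]; simp)+
  ultimately show ?thesis by simp
qed

lemma residue_bijections:
  "bij_betw (\<lambda>l. 3 * l) UNIV {l::int. l mod 3 = 0}" "bij_betw (\<lambda>l. -
    3 * l) UNIV {l::int. l mod 3 = 0}"
  "bij_betw (\<lambda>l. 3 * l + 1) UNIV {l::int. l mod 3 =
    1}" "bij_betw (\<lambda>l. 1 - 3 * l) UNIV {l::int. l mod 3 = 1}"
  "bij_betw (\<lambda>l. 3 * l - 1) UNIV {l::int. l mod 3 = 2}"
proof -
  show "bij_betw (\<lambda>l. 3 * l) UNIV {l::int. l mod 3 = 0}"
    by (rule bij_betw_byWitness[where f' = "\<lambda>l. l div 3"]) auto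
  show "bij_betw (\<lambda>l. - 3 * l) UNIV {l::int. l mod 3 = 0}"
    by (rule bij_betw_byWitness[where f' = "\<lambda>l. - (l div 3)"]) auto
  show "bij_betw (\<lambda>l. 3 * l + 1) UNIV {l::int. l mod 3 = 1}"
    by (rule bij_betw_byWitness[where f' = "\<lambda>l. l div 3"]) (auto, presburger+)
  show "bij_betw (\<lambda>l. 1 - 3 * l) UNIV {l::int. l mod 3 = 1}"
    by (rule bij_betw_byWitness[where f' = "\<lambda>l. - (l div 3)"]) (auto, presburger+)
  show "bij_betw (\<lambda>l. 3 * l - 1) UNIV {l::int. l mod 3 = 2}"
    by (rule bij_betw_byWitness[where f' = "\<lambda>l. l div 3 + 1"]) (auto, presburger+)
qed

text \<open>Split the summation index by its residue modulo 3. With exponent $l(l+1)/2$ the residues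
  0 and 2 are exchanged by $l \mapsto -1-l$, hence the factor 2.\<close>

lemma theta_psi_trisection:
  "theta 1 1 0 = 2 * dilate 3 (theta 1 1 2) + fps_X * dilate 9 (theta 1 1 0)"
proof -
  have e: "theta_exp 1 0 (- 3 * l) = int 0 + int 3 * theta_exp 1 2 l" "theta_exp 1 0 (3 * l -
    1) = int 0 + int 3 * theta_exp 1 2 l"
    "theta_exp 1 0 (3 * l + 1) = int 1 + int 9 * theta_exp 1 0 l" for l
    using two_tri[of "- 3 * l"] two_tri[of "3 * l - 1"] two_tri[of "3 * l + 1"]
      two_tri[of l] two_tri[of "l - 1"]
    by (simp_all add: theta_exp_def algebra_simps)
  have "gen_series (\<lambda>l. int 0 + int 3 * theta_exp 1 2 l) (\<lambda>_. 1) UNIV = dilate 3 (theta 1 1 2)"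
    "gen_series (\<lambda>l. int 1 + int 9 * theta_exp 1 0 l) (\<lambda>_. 1) UNIV = fps_X * dilate 9 (theta 1 1 0)"
    by (subst gen_series_affine; simp add: theta_exp_ge theta_def)+
  moreover have "theta 1 1 0 = gen_series (\<lambda>l. theta_exp 1 0 (- 3 * l)) (\<lambda>_. 1) UNIV +
      gen_series (\<lambda>l. theta_exp 1 0 (3 * l + 1)) (\<lambda>_. 1) UNIV +
        gen_series (\<lambda>l. theta_exp 1 0 (3 * l - 1)) (\<lambda>_. 1) UNIV"
    unfolding theta_def power_one
    by (rule gen_series_residues_3) (use residue_bijections finite_theta_exp_fibre in auto)
  ultimately show ?thesis unfolding e by simp
qed

lemma minus_one_power_nat_abs: "(-1 :: rat) ^ nat \<bar>l\<bar> = (if even l then 1 else -1)"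
  by (simp add: minus_one_power_iff even_nat_iff)

lemma gen_series_uminus: "gen_series e (\<lambda>x. - w x) A = - gen_series e w A"
  by (simp add: gen_series_def fps_eq_iff sum_negf)

text \<open>With exponent $l^2$ the residues 1 and 2 are exchanged by $l \mapsto -l$, hence the
  factor 2.\<close>

lemma theta_phi_trisection:
  "theta (-1) 1 1 = dilate 9 (theta (-1) 1 1) - 2 * fps_X * dilate 3 (theta (-1) 1 5)"
proof -
  define w :: "int \<Rightarrow> rat" where "w l = (-1) ^ nat \<bar>l\<bar>" for l
  have e: "theta_exp 1 1 (3 * l) = int 0 + int 9 * theta_exp 1 1 l" "theta_exp 1 1 (1 - 3 * l) =
    int 1 + int 3 * theta_exp 1 5 l"
    "theta_exp 1 1 (3 * l - 1) = int 1 + int 3 * theta_exp 1 5 l" for l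
    using two_tri[of "3 * l"] two_tri[of "3 * l - 1"] two_tri[of "1 - 3 * l"] two_tri[of "- 3 * l"]
      two_tri[of "3 * l - 2"] two_tri[of l] two_tri[of "l - 1"]
    by (simp_all add: theta_exp_def algebra_simps)
  have w: "w (3 * l) = w l" "w (1 - 3 * l) = - w l" "w (3 * l - 1) = - w l" for l
    by (simp_all add: w_def minus_one_power_nat_abs)
  have "gen_series (\<lambda>l. int 0 + int 9 * theta_exp 1 1 l) w UNIV = dilate 9 (theta (-1) 1 1)"
    "gen_series (\<lambda>l. int 1 + int 3 * theta_exp 1 5 l) w UNIV = fps_X * dilate 3 (theta (-1) 1 5)"
    by (subst gen_series_affine; simp add: theta_exp_ge theta_def w_def[abs_def])+
  moreover have "theta (-1) 1 1 = gen_series (\<lambda>l. theta_exp 1 1 (3 * l)) (\<lambda>l. w (3 * l)) UNIV +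
      gen_series (\<lambda>l. theta_exp 1 1 (1 - 3 * l)) (\<lambda>l. w (1 - 3 * l)) UNIV +
      gen_series (\<lambda>l. theta_exp 1 1 (3 * l - 1)) (\<lambda>l. w (3 * l - 1)) UNIV"
    unfolding theta_def w_def[symmetric]
    by (rule gen_series_residues_3) (use residue_bijections finite_theta_exp_fibre in auto)
  ultimately show ?thesis unfolding e w gen_series_uminus by (simp add: mult.assoc)
qed

section \<open>The even part of the series of triples\<close>

lemma B3_gf: "Abs_fps (\<lambda>n. of_nat (B3 n)) = cores_gf ^ 3"
proof -
  define K where "K = {xs. is_core 3 xs}"
  define s where "s xs = int (sum_list xs)" for xs :: "nat list"
  have fin: "finite {xs\<in>K. s xs = int n}" for n
    by (rule finite_subset[OF _ finite_partitions_le[of n]]) (auto simp: K_def s_def is_core_def)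
  have gf: "cores_gf = gen_series s (\<lambda>_. 1) K"
    by (simp add: cores_gf_def gen_series_def K_def s_def)
  have fin2: "finite {p\<in>K \<times> K. (case p of (ys, zs) \<Rightarrow> s ys + s zs) = int n}" for n
  proof (rule finite_subset)
    let ?P = "{xs. is_partition xs \<and> sum_list xs \<le> n}"
    show "{p\<in>K \<times> K. (case p of (ys, zs) \<Rightarrow> s ys + s zs) = int n} \<subseteq> ?P \<times> ?P"
      by (auto simp: K_def s_def is_core_def)
    show "finite (?P \<times> ?P)" using finite_partitions_le by blast
  qed
  have "cores_gf * cores_gf = gen_series (\<lambda>(ys, zs). s ys + s zs) (\<lambda>_. 1) (K \<times> K)"
    unfolding gf by (subst gen_series_mult[OF _ _ fin fin]) (auto simp: s_def case_prod_unfold)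
  then have "cores_gf ^ 3 = gen_series s (\<lambda>_. 1) K * gen_series (\<lambda>(ys, zs). s ys +
    s zs) (\<lambda>_. 1) (K \<times> K)"
    by (simp add: power3_eq_cube gf mult.assoc)
  also have "\<dots> = gen_series (\<lambda>(xs, p). s xs + (case p of (ys, zs) \<Rightarrow> s ys +
    s zs)) (\<lambda>_. 1) (K \<times> K \<times> K)"
    by (subst gen_series_mult[OF _ _ fin fin2]) (auto simp: s_def case_prod_unfold)
  also have "\<dots> = Abs_fps (\<lambda>n. of_nat (B3 n))"
  proof (rule fps_ext)
    fix n
    have "{p\<in>K \<times> K \<times> K. (\<lambda>(xs, p). s xs + (case p of (ys, zs) \<Rightarrow> s ys + s zs)) p = int n} =
      core_triples n"
      by (auto simp: K_def s_def core_triples_def)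
    then show "fps_nth (gen_series (\<lambda>(xs, p). s xs + (case p of (ys, zs) \<Rightarrow> s ys +
      s zs)) (\<lambda>_. 1) (K \<times> K \<times> K)) n =
        fps_nth (Abs_fps (\<lambda>n. of_nat (B3 n))) n"
      by (simp add: gen_series_def B3_def)
  qed
  finally show ?thesis by simp
qed

lemma double_cancel: "2 * F = 2 * G \<Longrightarrow> F = G" for F G :: "rat fps"
  by (simp only: mult_cancel_left) simp

text \<open>Ramanujan's $\psi(q) = \sum_{n \ge 0} q^{n(n+1)/2}$; summing over all integers counts
  each term twice.\<close>

definition psi :: "rat fps" where "psi = fps_const (1 / 2) * theta 1 1 0"

lemma theta_eq_psi: "theta 1 1 0 = 2 * psi"
  by (simp add: psi_def numeral_fps_const flip: mult.assoc)

lemma psi_f: "psi * f 1 = f 2 ^ 2"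
  using theta_eta_quotients(1) by (simp add: theta_eq_psi del: One_nat_def)

lemma psi_trisection: "psi = dilate 3 (theta 1 1 2) + fps_X * dilate 3 (dilate 3 psi)"
proof -
  have "2 * psi = 2 * (dilate 3 (theta 1 1 2) + fps_X * dilate 3 (dilate 3 psi))"
    using theta_psi_trisection by (simp add: theta_eq_psi dilate_dilate algebra_simps del:
      One_nat_def)
  then show ?thesis by (rule double_cancel)
qed

text \<open>Ramanujan's $\varphi(-q)$.\<close>

definition phi :: "rat fps" where "phi = theta (-1) 1 1"

lemma phi_trisection: "phi = dilate 3 (dilate 3 phi) - 2 * fps_X * dilate 3 (theta (-1) 1 5)"
  using theta_phi_trisection by (simp add: phi_def dilate_dilate del: One_nat_def)

text \<open>The even part of the cube of $A(q^2) + q B(q^2)$ is $A^3 + 3qAB^2$ at $q^2$; here $A =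
  \psi\Theta$ and $B = C(q^2)$.\<close>

definition B3_even_gf :: "rat fps" where
  "B3_even_gf = (psi * theta 1 1 2) ^ 3 + 3 * fps_X * (psi * theta 1 1 2) * dilate 2 cores_gf ^ 2"

lemma B3_even: "of_nat (B3 (2 * n)) = fps_nth B3_even_gf n"
proof -
  define A where "A = psi * theta 1 1 2"
  define B where "B = dilate 2 cores_gf"
  have "2 * cores_gf = 2 * (dilate 2 A + fps_X * dilate 2 B)"
    using cores_gf_bisection
    by (simp add: theta_eq_psi A_def B_def dilate_dilate algebra_simps del: One_nat_def)
  then have C: "cores_gf = dilate 2 A + fps_X * dilate 2 B" by (rule double_cancel)
  have "cores_gf ^ 3 = dilate 2 (A ^ 3 + 3 * fps_X * A * B ^ 2) +
    fps_X * dilate 2 (3 * A ^ 2 * B + fps_X * B ^ 3)"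
    unfolding C by (simp add: algebra_simps power2_eq_square power3_eq_cube)
  moreover have "of_nat (B3 (2 * n)) = fps_nth (cores_gf ^ 3) (2 * n)"
    by (simp flip: B3_gf)
  moreover have "\<not> 2 dvd 2 * n - 1 \<or> n = 0" by presburger
  ultimately show ?thesis
    by (auto simp: dilate_nth B3_even_gf_def A_def B_def simp del: dilate_ring One_nat_def)
qed

section \<open>Identities between eta quotients\<close>

text \<open>Pure algebra in a field: \<open>p\<close>, \<open>T\<close>, \<open>B\<close>, \<open>h\<close> stand for $\psi$, $\Theta$, $C(q^2)$ and
  $\varphi$.\<close>

lemma even_part_identity:
  fixes f1 f2 f3 f6 q T B p h :: "'a::field"
  assumes nz: "f1 \<noteq> 0" "f2 \<noteq> 0" "f3 \<noteq> 0" "f6 \<noteq> 0"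
    and "p * f1 = f2 ^ 2" "T * f1 * f6 = f2 * f3 ^ 2" "B * f2 = f6 ^ 3" "h * f2 = f1 ^ 2"
  shows "((p * T) ^ 3 + 3 * q * (p * T) * B ^ 2) * h * f6 ^ 3 =
    f3 ^ 6 * p ^ 4 + 3 * q * f6 ^ 8 * f3 ^ 2"
proof -
  have e: "p = f2 ^ 2 / f1" "T = f2 * f3 ^ 2 / (f1 * f6)" "B = f6 ^ 3 / f2" "h = f1 ^ 2 / f2"
    using assms by (simp_all add: field_simps)
  show ?thesis unfolding e using nz by (simp add: field_simps eval_nat_numeral)
qed

text \<open>The algebraic core, valid in any field. Both \<open>T\<close> and \<open>Y\<close> (the components of $\psi$) are
  $f_2/f_1$ times \<open>x\<close> and \<open>y\<close> (where \<open>x\<close> and $-2y$ are the components of $\varphi$), and \<open>n1\<close>,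
  \<open>n2\<close> are the norms of $f_1$, $f_2$; so the two norms \<open>Np\<close> and \<open>Nh\<close> express $W = x^3 + qy^3$
  and $D = x^3 - 8qy^3$ by the $f_k$. The relation $f_2^4 = yW$ then makes the two right-hand
  sides polynomials in \<open>q\<close>, \<open>x\<close> and \<open>y\<close> up to the common factor $f_1^2 f_2^4$.\<close>

lemma eta_quotient_identities:
  fixes f1 f2 f3 f6 q x y T Y n1 n2 e0 e2 r1 r2 r3 r4 :: "'a::field"
  assumes nz: "f1 \<noteq> 0" "f2 \<noteq> 0" "f3 \<noteq> 0" "f6 \<noteq> 0"
    and x: "x * f6 = f3 ^ 2" and y: "y * f2 * f3 = f1 * f6 ^ 2"
    and T: "T * f1 * f6 = f2 * f3 ^ 2" and Y: "Y * f3 = f6 ^ 2"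
    and n: "n1 * f3 = f1 ^ 4" "n2 * f6 = f2 ^ 4"
    and Np: "(T ^ 3 + q * Y ^ 3) * n1 = n2 ^ 2" and Nh: "(x ^ 3 - 8 * q * y ^ 3) * n2 = n1 ^ 2"
    and e0: "e0 * (x ^ 3 - 8 * q * y ^ 3) * f2 ^ 3 = f1 ^ 6 * (x ^ 2 * (T ^ 4 + 4 * q * T * Y ^ 3)
       + q * (2 * x * y * (6 * T ^ 2 * Y ^ 2) + 4 * y ^ 2 * (4 * T ^ 3 * Y + q * Y ^ 4)))
       + 12 * q * f2 ^ 8 * f1 ^ 2 * y ^ 2"
    and e2: "e2 * (x ^ 3 - 8 * q * y ^ 3) * f2 ^ 3 = f1 ^ 6 * (x ^ 2 * (6 * T ^ 2 * Y ^ 2)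
       + 2 * x * y * (4 * T ^ 3 * Y + q * Y ^ 4) + 4 * y ^ 2 * (T ^ 4 + 4 * q * T * Y ^ 3))
       + 6 * f2 ^ 8 * f1 ^ 2 * x * y"
    and r: "r1 * (f1 ^ 7 * f6 ^ 6) = f2 ^ 10 * f3 ^ 9" "r2 * f1 ^ 4 = f2 ^ 7 * f6 ^ 3"
      "r3 * f1 ^ 3 = f2 ^ 2 * f3 ^ 5 * f6 ^ 2" "r4 * f1 ^ 5 = f2 ^ 8 * f3 ^ 3"
  shows "e0 = r1 + 16 * q * r2 + 27 * q * r3" "e2 = 24 * r4"
proof -
  define W where "W = x ^ 3 + q * y ^ 3"
  define D where "D = x ^ 3 - 8 * q * y ^ 3"
  define c where "c = f2 / f1"
  have xe: "x = f3 ^ 2 / f6" and ye: "y = f1 * f6 ^ 2 / (f2 * f3)"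
    using nz x y by (simp_all add: field_simps)
  have "T * f1 * f6 = f2 * x * f6" using T unfolding x[symmetric] by (simp only: mult_ac)
  moreover have "Y * f1 * f3 = f2 * y * f3" using y unfolding Y[symmetric] by (simp only: mult_ac)
  ultimately have "T * f1 = f2 * x" "Y * f1 = f2 * y" using nz by simp_all
  then have Te: "T = c * x" and Ye: "Y = c * y"
    using nz by (simp_all add: field_simps c_def)
  have ne: "n1 = f1 ^ 4 / f3" "n2 = f2 ^ 4 / f6" using n nz by (simp_all add: field_simps)
  have "c ^ 3 * W * n1 = n2 ^ 2"
    using Np unfolding W_def Te Ye by (simp add: algebra_simps power_mult_distrib)
  then have W: "W = f2 ^ 5 * f3 / (f1 * f6 ^ 2)"
    using nz unfolding ne c_def by (simp add: field_simps eval_nat_numeral)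
  have D: "D = f1 ^ 8 * f6 / (f2 ^ 4 * f3 ^ 2)"
    using Nh nz unfolding D_def[symmetric] ne by (simp add: field_simps eval_nat_numeral)
  have yW: "f2 ^ 4 = y * W"
    using nz unfolding W ye by (simp add: field_simps eval_nat_numeral)
  have c: "f1 ^ 6 * c ^ 4 = f1 ^ 2 * f2 ^ 4"
    using nz unfolding c_def by (simp add: field_simps eval_nat_numeral)
  have "e0 * D * f2 ^ 3 = (f1 ^ 6 * c ^ 4) * (x ^ 6 + 32 * q * x ^ 3 * y ^ 3 + 4 * q ^ 2 * y ^ 6)
      + 12 * q * (f2 ^ 4 * f2 ^ 4) * f1 ^ 2 * y ^ 2"
    unfolding D_def e0 Te Ye by (simp add: algebra_simps eval_nat_numeral)
  also have "\<dots> = f1 ^ 2 * f2 ^ 4 * (x ^ 6 + 32 * q * x ^ 3 * y ^ 3 + 4 * q ^ 2 * y ^ 6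
      + 12 * q * (y * W) * y ^ 2)"
    unfolding c yW[symmetric] by (simp add: algebra_simps)
  also have "\<dots> = f1 ^ 2 * f2 ^ 4 * (x ^ 3 * W + 16 * (q * y ^ 3 * W) + 27 * (q * x ^ 3 * y ^ 3))"
    unfolding W_def by (simp add: algebra_simps eval_nat_numeral)
  finally have E0: "e0 * (D * f2 ^ 3) = \<dots>" by (simp only: mult.assoc)
  have "e2 * D * f2 ^ 3 = (f1 ^ 6 * c ^ 4) * (18 * x ^ 4 * y ^ 2 + 18 * q * x * y ^ 5)
      + 6 * (f2 ^ 4 * f2 ^ 4) * f1 ^ 2 * x * y"
    unfolding D_def e2 Te Ye by (simp add: algebra_simps eval_nat_numeral)
  also have "\<dots> = f1 ^ 2 * f2 ^ 4 * (18 * x ^ 4 * y ^ 2 + 18 * q * x * y ^ 5 + 6 * (y * W) * x * y)"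
    unfolding c yW[symmetric] by (simp add: algebra_simps)
  also have "\<dots> = f1 ^ 2 * f2 ^ 4 * (24 * (x * y ^ 2 * W))"
    unfolding W_def by (simp add: algebra_simps eval_nat_numeral)
  finally have E2: "e2 * (D * f2 ^ 3) = \<dots>" by (simp only: mult.assoc)
  \<comment> \<open>The common factor of all terms; it equals $f_2^5 f_3^2 / (f_1^6 f_6)$.\<close>
  define g where "g = f1 ^ 2 * f2 ^ 4 / (D * f2 ^ 3)"
  have D0: "D * f2 ^ 3 \<noteq> 0" using nz by (simp add: D)
  have r': "g * (x ^ 3 * W) = r1" "g * (y ^ 3 * W) = r2" "g * (x ^ 3 * y ^ 3) =
    r3" "g * (x * y ^ 2 * W) = r4"
  proof -
    have re: "r1 = f2 ^ 10 * f3 ^ 9 / (f1 ^ 7 * f6 ^ 6)" "r2 = f2 ^ 7 * f6 ^ 3 / f1 ^ 4"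
      "r3 = f2 ^ 2 * f3 ^ 5 * f6 ^ 2 / f1 ^ 3" "r4 = f2 ^ 8 * f3 ^ 3 / f1 ^ 5"
      using r nz by (simp_all add: field_simps)
    show "g * (x ^ 3 * W) = r1" "g * (y ^ 3 * W) = r2" "g * (x ^ 3 * y ^ 3) =
      r3" "g * (x * y ^ 2 * W) = r4"
      unfolding g_def re W D xe ye using nz by (simp_all add: field_simps eval_nat_numeral)
  qed
  have "e0 = g * (x ^ 3 * W + 16 * (q * y ^ 3 * W) + 27 * (q * x ^ 3 * y ^ 3))"
    using E0 D0 by (simp add: g_def field_simps)
  also have "\<dots> = g * (x ^ 3 * W) + 16 * q * (g * (y ^ 3 * W)) + 27 * q * (g * (x ^ 3 * y ^ 3))"
    by (simp add: algebra_simps)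
  finally show "e0 = r1 + 16 * q * r2 + 27 * q * r3" unfolding r' .
  have "e2 = g * (24 * (x * y ^ 2 * W))"
    using E2 D0 by (simp add: g_def field_simps)
  also have "\<dots> = 24 * (g * (x * y ^ 2 * W))" by simp
  finally show "e2 = 24 * r4" unfolding r' .
qed

section \<open>The trisection of the even part\<close>

lemma f_nonzero: "k > 0 \<Longrightarrow> f k \<noteq> 0"
  using f_has_prod(2)[of k] by auto

lemma f_div_mult: "fps_nth G 0 \<noteq> 0 \<Longrightarrow> F / G * G = F" for F G :: "rat fps"
  by (simp add: fps_divide_unit mult.assoc inverse_mult_eq_1)

lemma B3_even_gf_times_phi:
  "B3_even_gf * phi * f 6 ^ 3 = f 3 ^ 6 * psi ^ 4 + 3 * fps_X * f 6 ^ 8 * f 3 ^ 2"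
proof -
  have B: "dilate 2 cores_gf * f 2 = f 6 ^ 3"
    using arg_cong[OF cores_gf_product, of "dilate 2"] by (simp add: dilate_f del: One_nat_def)
  note eqs = psi_f theta_eta_quotients(2) B theta_eta_quotients(3)[folded phi_def]
  note eqs' = eqs[THEN arg_cong[where f = fps_to_fls], unfolded fls_times_fps_to_fls
    fps_to_fls_power]
  have "fps_to_fls (B3_even_gf * phi * f 6 ^ 3) =
      fps_to_fls (f 3 ^ 6 * psi ^ 4 + 3 * fps_X * f 6 ^ 8 * f 3 ^ 2)"
    unfolding B3_even_gf_def fls_times_fps_to_fls fps_to_fls_power fps_to_fls_plus
      fps_to_fls_numeral
    by (rule even_part_identity[OF _ _ _ _ eqs']) (simp_all add: f_nonzero)
  then show ?thesis by (simp only: fps_to_fls_eq_iff)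
qed

text \<open>Multiply $E\varphi f_6^3 = f_3^6\psi^4 + 3qf_6^8f_3^2$ by the cofactor \<open>J\<close> of $\varphi$
  in its norm. All denominators become series in $q^3$, so that taking the terms with exponents
  0 and 2 mod 3 commutes with multiplying by them. The identities for fields apply inside the
  formal Laurent series.\<close>

theorem B3_even_gf_trisection:
  "part3 0 B3_even_gf = f 2 ^ 10 * f 3 ^ 9 / (f 1 ^ 7 * f 6 ^ 6)
      + 16 * fps_X * (f 2 ^ 7 * f 6 ^ 3 / f 1 ^ 4) +
        27 * fps_X * (f 2 ^ 2 * f 3 ^ 5 * f 6 ^ 2 / f 1 ^ 3)"
  "part3 2 B3_even_gf = 24 * (f 2 ^ 8 * f 3 ^ 3 / f 1 ^ 5)"
proof -
  define x y T Y where xyTY: "x = dilate 3 phi" "y = theta (-1) 1 5" "T = theta 1 1 2" "Y =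
    dilate 3 psi"
  define J where "J = dilate 3 (x ^ 2) + fps_X * dilate 3 (2 * x * y) +
    fps_X ^ 2 * dilate 3 (4 * y ^ 2)"
  have psi: "psi = dilate 3 T + fps_X * dilate 3 Y + fps_X ^ 2 * dilate 3 0"
    using psi_trisection by (simp add: xyTY del: One_nat_def)
  have phi: "phi = dilate 3 x + fps_X * dilate 3 (- 2 * y) + fps_X ^ 2 * dilate 3 0"
    using phi_trisection by (simp add: xyTY mult_ac del: One_nat_def)
  note parts = part3_trisect[OF psi, unfolded One_nat_def] part3_trisect[OF phi, unfolded
    One_nat_def]
    part3_trisect[OF J_def, unfolded One_nat_def]
  have norm_psi: "norm3 psi = T ^ 3 + fps_X * Y ^ 3" by (simp add: norm3_def parts)
  have norm_phi: "norm3 phi = x ^ 3 - 8 * fps_X * y ^ 3"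
    by (simp add: norm3_def parts power_mult_distrib algebra_simps)
  have n: "norm3 (f 1) * f 3 = f 1 ^ 4" "norm3 (f 2) * f 6 = f 2 ^ 4"
    using norm3_f[of 1] norm3_f[of 2] by simp_all
  have Np: "(T ^ 3 + fps_X * Y ^ 3) * norm3 (f 1) = norm3 (f 2) ^ 2"
    using arg_cong[OF psi_f, of norm3] by (simp only: norm3_mult norm3_power norm_psi)
  have Nh: "(x ^ 3 - 8 * fps_X * y ^ 3) * norm3 (f 2) = norm3 (f 1) ^ 2"
    using arg_cong[OF theta_eta_quotients(3)[folded phi_def], of norm3] by
      (simp only: norm3_mult norm3_power norm_phi)
  \<comment> \<open>$(x - 2qy)(x^2 + 2qxy + 4q^2y^2) = x^3 - 8q^3y^3$\<close>
  have phiJ: "phi * J = dilate 3 (x ^ 3 - 8 * fps_X * y ^ 3)"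
    unfolding phi J_def by (simp add: algebra_simps eval_nat_numeral)
  have key: "dilate 3 ((x ^ 3 - 8 * fps_X * y ^ 3) * f 2 ^ 3) * B3_even_gf =
      dilate 3 (f 1 ^ 6) * (J * (psi ^ 2 * psi ^ 2)) +
        dilate 3 (3 * f 2 ^ 8 * f 1 ^ 2) * (fps_X * J)"
  proof -
    have "dilate 3 ((x ^ 3 - 8 * fps_X * y ^ 3) * f 2 ^ 3) = (phi * J) * f 6 ^ 3"
      using dilate_ring(3)[of 3 "x ^ 3 - 8 * fps_X * y ^ 3" "f 2 ^ 3"] dilate_f[of 3 2]
      unfolding phiJ by (simp only: dilate_ring(4)) simp
    then have "dilate 3 ((x ^ 3 - 8 * fps_X * y ^ 3) * f 2 ^ 3) * B3_even_gf =
        J * (B3_even_gf * phi * f 6 ^ 3)" by (simp only: mult_ac)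
    also have "\<dots> = J * (f 3 ^ 6 * psi ^ 4 + 3 * fps_X * f 6 ^ 8 * f 3 ^ 2)"
      by (simp only: B3_even_gf_times_phi)
    also have "\<dots> = dilate 3 (f 1 ^ 6) * (J * (psi ^ 2 * psi ^ 2)) +
      dilate 3 (3 * f 2 ^ 8 * f 1 ^ 2) * (fps_X * J)"
      using dilate_f[of 3 1] dilate_f[of 3 2]
      by (simp add: algebra_simps del: One_nat_def flip: power_add)
    finally show ?thesis .
  qed
  have p2: "part3 0 (psi ^ 2) = T ^ 2" "part3 (Suc 0) (psi ^ 2) = 2 * T * Y" "part3 2 (psi ^ 2) =
    Y ^ 2"
    by (simp_all add: power2_eq_square part3_mult[where F = psi and G = psi] parts)
  have p4: "part3 0 (psi ^ 2 * psi ^ 2) = T ^ 4 + 4 * fps_X * T * Y ^ 3"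
    "part3 (Suc 0) (psi ^ 2 * psi ^ 2) = 4 * T ^ 3 * Y + fps_X * Y ^ 4"
    "part3 2 (psi ^ 2 * psi ^ 2) = 6 * T ^ 2 * Y ^ 2"
    unfolding part3_mult p2 by (simp_all add: algebra_simps eval_nat_numeral)
  have e0: "part3 0 B3_even_gf * (x ^ 3 - 8 * fps_X * y ^ 3) * f 2 ^ 3 =
       f 1 ^ 6 * (x ^ 2 * (T ^ 4 + 4 * fps_X * T * Y ^ 3)
       + fps_X * (2 * x * y * (6 * T ^ 2 * Y ^ 2) + 4 * y ^ 2 * (4 * T ^ 3 * Y + fps_X * Y ^ 4)))
       + 12 * fps_X * f 2 ^ 8 * f 1 ^ 2 * y ^ 2"
    using arg_cong[OF key, of "part3 0"]
    unfolding part3_add part3_dilate_mult part3_mult(1)[of J] part3_mult(1)[of fps_X] p4 parts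
      part3_X
    by (simp add: mult_ac)
  have e2: "part3 2 B3_even_gf * (x ^ 3 - 8 * fps_X * y ^ 3) * f 2 ^ 3 =
       f 1 ^ 6 * (x ^ 2 * (6 * T ^ 2 * Y ^ 2)
       + 2 * x * y * (4 * T ^ 3 * Y + fps_X * Y ^ 4) + 4 * y ^ 2 * (T ^ 4 + 4 * fps_X * T * Y ^ 3))
       + 6 * f 2 ^ 8 * f 1 ^ 2 * x * y"
    using arg_cong[OF key, of "part3 2"]
    unfolding part3_add part3_dilate_mult part3_mult(3)[of J] part3_mult(3)[of fps_X] p4 parts
      part3_X
    by (simp add: mult_ac)
  have x: "x * f 6 = f 3 ^ 2" and Y: "Y * f 3 = f 6 ^ 2"
    using arg_cong[OF theta_eta_quotients(3)[folded phi_def], of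
      "dilate 3"] arg_cong[OF psi_f, of "dilate 3"]
    by (simp_all add: xyTY dilate_f del: One_nat_def)
  have unit: "fps_nth (f 1 ^ k) 0 \<noteq> 0" "fps_nth (f 1 ^ k * f 6 ^ l) 0 \<noteq> 0" for k l
    using f_has_prod(2)[of 1] f_has_prod(2)[of 6] by (simp_all add: fps_power_zeroth)
  note r = f_div_mult[OF unit(2), of "f 2 ^ 10 * f 3 ^ 9" 7 6] f_div_mult[OF unit(1), of
    "f 2 ^ 7 * f 6 ^ 3" 4]
    f_div_mult[OF unit(1), of "f 2 ^ 2 * f 3 ^ 5 *
      f 6 ^ 2" 3] f_div_mult[OF unit(1), of "f 2 ^ 8 * f 3 ^ 3" 5]
  note eqs = x theta_eta_quotients(4)[folded xyTY] theta_eta_quotients(2)[folded xyTY] Y n Np Nh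
    e0 e2 r
  note hom = fls_times_fps_to_fls fps_to_fls_power fps_to_fls_plus fps_to_fls_minus
    fps_to_fls_numeral
  note eqs' = eqs[THEN arg_cong[where f = fps_to_fls], unfolded hom]
  note fin = eta_quotient_identities[OF _ _ _ _ eqs']
  have "fps_to_fls (part3 0 B3_even_gf) = fps_to_fls (f 2 ^ 10 * f 3 ^ 9 / (f 1 ^ 7 * f 6 ^ 6)
      + 16 * fps_X * (f 2 ^ 7 * f 6 ^ 3 / f 1 ^ 4) +
        27 * fps_X * (f 2 ^ 2 * f 3 ^ 5 * f 6 ^ 2 / f 1 ^ 3))"
    unfolding hom by (rule fin(1)) (simp_all add: f_nonzero)
  then show "part3 0 B3_even_gf = f 2 ^ 10 * f 3 ^ 9 / (f 1 ^ 7 * f 6 ^ 6)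
      + 16 * fps_X * (f 2 ^ 7 * f 6 ^ 3 / f 1 ^ 4) +
        27 * fps_X * (f 2 ^ 2 * f 3 ^ 5 * f 6 ^ 2 / f 1 ^ 3)"
    by (simp only: fps_to_fls_eq_iff)
  have "fps_to_fls (part3 2 B3_even_gf) = fps_to_fls (24 * (f 2 ^ 8 * f 3 ^ 3 / f 1 ^ 5))"
    unfolding hom by (rule fin(2)) (simp_all add: f_nonzero)
  then show "part3 2 B3_even_gf = 24 * (f 2 ^ 8 * f 3 ^ 3 / f 1 ^ 5)"
    by (simp only: fps_to_fls_eq_iff)
qed

theorem theorem2p4:
  shows "Abs_fps (\<lambda>n. of_nat (B3 (6 * n))) =
           f 2 ^ 10 * f 3 ^ 9 / (f 1 ^ 7 * f 6 ^ 6)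
           + 16 * fps_X * (f 2 ^ 7 * f 6 ^ 3 / f 1 ^ 4)
           + 27 * fps_X * (f 2 ^ 2 * f 3 ^ 5 * f 6 ^ 2 / f 1 ^ 3)
       \<and> Abs_fps (\<lambda>n. of_nat (B3 (6 * n + 4))) = 24 * (f 2 ^ 8 * f 3 ^ 3 / f 1 ^ 5)"
proof -
  have "6 * n = 2 * (3 * n)" "6 * n + 4 = 2 * (3 * n + 2)" for n :: nat by simp_all
  then have "of_nat (B3 (6 * n)) = fps_nth (part3 0 B3_even_gf) n"
    "of_nat (B3 (6 * n + 4)) = fps_nth (part3 2 B3_even_gf) n" for n
    by (simp_all only: B3_even part3_def fps_nth_Abs_fps add_0_right)
  then show ?thesis
    unfolding B3_even_gf_trisection[symmetric] by (simp add: fps_eq_iff)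
qed

end
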